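(* Let $G$ be a finite unweighted digraph without loops, with adjacency matrix $A$ and directed deformed graph Laplacian $M(t)=I-At+(D-I)t^2+(A-S)t^3$. Let $\mu$, with $0<\mu\le 1$, be the smallest positive real eigenvalue of $M(t)$, and let $r$ be the radius of convergence of the power series $\sum_{k=0}^\infty t^k p_k(A)$ (which equals $(1-t^2)M(t)^{-1}$ near $t=0$). Let $G_1,\dots,G_s$ be the strongly connected or single node components of $G$ and $H_1,\dots,H_s$ their undirectizations. Then: (a) if every $H_i$ is a tree or an isolated node, then $1=\mu<r=\infty$; (b) if no $H_i$ has more than one cycle but at least one $H_i$ has exactly one cycle, then $1=\mu=r$; (c) if at least one $H_i$ has more than one cycle, then $1>\mu=r$.
   Context: A digraph $G=(V,E)$ has vertex set $V=\{1,\dots,n\}$ and edge set $E\subseteq V\times V$ of ordered pairs (no multiple edges, no loops $(i,i)$). Its adjacency matrix $A$ has $A_{ij}=1$ if $(i,j)\in E$ and $0$ otherwise. $S=A\circ A^T$ (entrywise product) and $D=\mathrm{diag}(\mathrm{diag}(A^2))$, i.e. $D_{ii}$ is the number of $j$ with both $(i,j),(j,i)\in E$. A walk of length $k$ is a sequence of vertices $(v_1,\dots,v_{k+1})$ with $(v_r,v_{r+1})\in E$ for all $r$; it is non-backtracking (NBTW) if $v_{r+2}\neq v_r$ for all $r$. $p_k(A)$ is the $n\times n$ matrix whose $(i,j)$ entry is the number of NBTWs of length $k$ from $i$ to $j$ ($p_0(A)=I$). A finite eigenvalue of a square polynomial matrix $M(t)$ with $\det M(t)\not\equiv 0$ is a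 root of $\det M(t)$. The undirectization of $G$ is the undirected simple graph on $V$ with an edge $\{i,j\}$ whenever $(i,j)\in E$ or $(j,i)\in E$. The strongly connected or single node components of $G$ are the induced subgraphs on the equivalence classes of the relation "$i=j$, or there are directed walks from $i$ to $j$ and from $j$ to $i$". A cycle in an undirected graph is a closed path (distinct vertices except first=last) of length $\ge 3$, up to cyclic permutations and reversal. *)

theory Defs
  imports "HOL-Analysis.Analysis"
begin

definition adj_mat :: "('n::finite \<Rightarrow> 'n \<Rightarrow> bool) \<Rightarrow> real^'n^'n" where
  "adj_mat E = (\<chi> i j. if E i j then 1 else 0)"

definition S_mat :: "('n::finite \<Rightarrow> 'n \<Rightarrow> bool) \<Rightarrow> real^'n^'n" where
  "S_mat E = (\<chi> i j. adj_mat E $ i $ j * adj_mat E $ j $ i)"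

definition D_mat :: "('n::finite \<Rightarrow> 'n \<Rightarrow> bool) \<Rightarrow> real^'n^'n" where
  "D_mat E = (\<chi> i j. if i = j then (adj_mat E ** adj_mat E) $ i $ i else 0)"

definition deformed_laplacian :: "('n::finite \<Rightarrow> 'n \<Rightarrow> bool) \<Rightarrow> real \<Rightarrow> real^'n^'n" where
  "deformed_laplacian E t =
     mat 1 - t *\<^sub>R adj_mat E + (t^2) *\<^sub>R (D_mat E - mat 1)
       + (t^3) *\<^sub>R (adj_mat E - S_mat E)"

definition mu_eig :: "('n::finite \<Rightarrow> 'n \<Rightarrow> bool) \<Rightarrow> real" where
  "mu_eig E = (LEAST t::real. 0 < t \<and> det (deformed_laplacian E t) = 0)"

definition is_walk :: "('n \<Rightarrow> 'n \<Rightarrow> bool) \<Rightarrow> 'n list \<Rightarrow> bool" where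
  "is_walk E vs \<longleftrightarrow> vs \<noteq> [] \<and> (\<forall>r. Suc r < length vs \<longrightarrow> E (vs ! r) (vs ! Suc r))"

definition is_nbtw :: "('n \<Rightarrow> 'n \<Rightarrow> bool) \<Rightarrow> 'n list \<Rightarrow> bool" where
  "is_nbtw E vs \<longleftrightarrow> is_walk E vs \<and> (\<forall>r. r + 2 < length vs \<longrightarrow> vs ! (r + 2) \<noteq> vs ! r)"

definition nbtws :: "('n \<Rightarrow> 'n \<Rightarrow> bool) \<Rightarrow> nat \<Rightarrow> 'n \<Rightarrow> 'n \<Rightarrow> 'n list set" where
  "nbtws E k i j = {vs. length vs = k + 1 \<and> is_nbtw E vs \<and> hd vs = i \<and> last vs = j}"

definition p_mat :: "('n::finite \<Rightarrow> 'n \<Rightarrow> bool) \<Rightarrow> nat \<Rightarrow> real^'n^'n" where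
  "p_mat E k = (\<chi> i j. real (card (nbtws E k i j)))"

definition scc_classes :: "('n \<Rightarrow> 'n \<Rightarrow> bool) \<Rightarrow> 'n set set" where
  "scc_classes E = {{j. E\<^sup>*\<^sup>* i j \<and> E\<^sup>*\<^sup>* j i} | i. True}"

definition undir_adj :: "('n \<Rightarrow> 'n \<Rightarrow> bool) \<Rightarrow> 'n set \<Rightarrow> 'n \<Rightarrow> 'n \<Rightarrow> bool" where
  "undir_adj E C x y \<longleftrightarrow> x \<in> C \<and> y \<in> C \<and> x \<noteq> y \<and> (E x y \<or> E y x)"

definition is_cycle_list :: "'n set \<Rightarrow> ('n \<Rightarrow> 'n \<Rightarrow> bool) \<Rightarrow> 'n list \<Rightarrow> bool" where
  "is_cycle_list C U vs \<longleftrightarrow> length vs \<ge> 3 \<and> distinct vs \<and> set vs \<subseteq> C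
     \<and> (\<forall>r. Suc r < length vs \<longrightarrow> U (vs ! r) (vs ! Suc r)) \<and> U (last vs) (hd vs)"

definition cycle_class :: "'n list \<Rightarrow> 'n list set" where
  "cycle_class vs = {rotate k vs | k. True} \<union> {rotate k (rev vs) | k. True}"

definition cycles :: "'n set \<Rightarrow> ('n \<Rightarrow> 'n \<Rightarrow> bool) \<Rightarrow> 'n list set set" where
  "cycles C U = {cycle_class vs | vs. is_cycle_list C U vs}"

definition ugraph_connected :: "'n set \<Rightarrow> ('n \<Rightarrow> 'n \<Rightarrow> bool) \<Rightarrow> bool" where
  "ugraph_connected C U \<longleftrightarrow> (\<forall>x\<in>C. \<forall>y\<in>C. (\<lambda>a b. U a b \<and> a \<in> C \<and> b \<in> C)\<^sup>*\<^sup>* x y)"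

definition is_tree :: "'n set \<Rightarrow> ('n \<Rightarrow> 'n \<Rightarrow> bool) \<Rightarrow> bool" where
  "is_tree C U \<longleftrightarrow> C \<noteq> {} \<and> ugraph_connected C U \<and> cycles C U = {}"

definition is_isolated_node :: "'n set \<Rightarrow> ('n \<Rightarrow> 'n \<Rightarrow> bool) \<Rightarrow> bool" where
  "is_isolated_node C U \<longleftrightarrow> card C = 1"

end

theory Submission
  imports Defs
begin

text \<open>
  Let a k be the total number of non-backtracking walks of length k. The generating functions of the
  walks from i to j and of those with prescribed first step satisfy a linear system whose solution is
  \<open>M(t) F(t) = (1 - t\<^sup>2) I\<close>; hence \<open>M(t)\<close> is regular for \<open>0 < t < min 1 r\<close>. As a is submultiplicative, the
  series diverges at its radius of convergence r if r is finite, which forces \<open>det M(r) = 0\<close>; and \<open>M(1)\<close> is the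
  Laplacian of the reciprocal edges, hence singular. So \<open>\<mu> = min 1 r\<close>, and it remains to locate r.

  Without cycles all non-backtracking walks are paths, and a directed cycle gives walks of every length. If
  a component has two cycles, take a directed cycle Z in it. A walk that leaves Z and returns to
  it yields two different non-backtracking loops at one edge and so exponential growth; if there is no such
  detour, then the component is Z with trees attached. Conversely, if some edge has two successors in
  the non-backtracking edge graph from both of which one can return, then its component has two
  cycles; if there is no such edge, then the growth is subexponential.
\<close>

section \<open>Non-backtracking walks\<close>

lemma is_nbtw_Nil [simp]: "\<not> is_nbtw E []"
  by (simp add: is_nbtw_def is_walk_def)

lemma is_nbtw_single [simp]: "is_nbtw E [x]"
  by (simp add: is_nbtw_def is_walk_def)

lemma is_nbtw_Cons_Cons:
  "is_nbtw E (x # y # zs) \<longleftrightarrow> E x y \<and> is_nbtw E (y # zs) \<and> (zs \<noteq> [] \<longrightarrow> hd zs \<noteq> x)"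
proof -
  have 1: "is_walk E (x # y # zs) \<longleftrightarrow> E x y \<and> is_walk E (y # zs)"
    by (auto simp: is_walk_def less_Suc_eq_0_disj nth_Cons split: nat.splits)
  have 2: "(\<forall>r. r + 2 < length (x # y # zs) \<longrightarrow> (x # y # zs) ! (r + 2) \<noteq> (x # y # zs) ! r) \<longleftrightarrow>
    (zs \<noteq> [] \<longrightarrow> hd zs \<noteq> x) \<and> (\<forall>r. r + 2 < length (y # zs) \<longrightarrow> (y # zs) ! (r + 2) \<noteq> (y # zs) ! r)"
    (is "(\<forall>r. ?P r) \<longleftrightarrow> ?a \<and> (\<forall>r. ?Q r)")
  proof -
    have "?P 0 \<longleftrightarrow> ?a" by (cases zs) auto
    moreover have "?P (Suc r) \<longleftrightarrow> ?Q r" for r by simp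
    moreover have "(\<forall>r. ?P r) \<longleftrightarrow> ?P 0 \<and> (\<forall>r. ?P (Suc r))" 
      using not0_implies_Suc by metis
    ultimately show ?thesis by presburger
  qed
  show ?thesis unfolding is_nbtw_def 1 2 by blast
qed

text \<open>Only one triple of consecutive vertices has the joint \<open>x\<close> in its middle;
  all others lie in one of the two parts.\<close>

lemma is_nbtw_append_iff:
  "is_nbtw E (xs @ x # ys) \<longleftrightarrow>
     is_nbtw E (xs @ [x]) \<and> is_nbtw E (x # ys) \<and> (xs \<noteq> [] \<longrightarrow> ys \<noteq> [] \<longrightarrow> last xs \<noteq> hd ys)"
proof (induction xs)
  case Nil
  then show ?case by simp
next
  case (Cons a xs)
  show ?case
  proof (cases xs)
    case Nil
    then show ?thesis by (auto simp: is_nbtw_Cons_Cons)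
  next
    case (Cons b bs)
    then show ?thesis using Cons.IH by (cases bs) (auto simp: is_nbtw_Cons_Cons)
  qed
qed

text \<open>When the two walks share a whole edge, every triple lies in one of them, so gluing
  imposes no condition at the joint.\<close>

lemma is_nbtw_overlap:
  "is_nbtw E (xs @ [u, v]) \<Longrightarrow> is_nbtw E (u # v # ys) \<Longrightarrow> is_nbtw E (xs @ u # v # ys)"
  by (metis append_Cons append_Nil is_nbtw_append_iff list.distinct(1) list.sel(1))

lemma is_nbtw_rev: "is_nbtw E (rev xs) \<longleftrightarrow> is_nbtw (\<lambda>x y. E y x) xs"
proof (induction xs)
  case Nil
  then show ?case by simp
next
  case (Cons a xs)
  show ?case
  proof (cases xs)
    case Nil
    then show ?thesis by simp
  next
    case (Cons b bs)
    then show ?thesis using Cons.IH is_nbtw_append_iff[of E "rev bs" b "[a]"]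
      by (auto simp: is_nbtw_Cons_Cons last_rev)
  qed
qed

lemma is_nbtw_mono: "is_nbtw E xs \<Longrightarrow> (\<And>x y. E x y \<Longrightarrow> F x y) \<Longrightarrow> is_nbtw F xs"
  by (auto simp: is_nbtw_def is_walk_def)

lemma is_nbtw_appendD1: "is_nbtw E (xs @ ys) \<Longrightarrow> xs \<noteq> [] \<Longrightarrow> is_nbtw E xs"
  by (cases xs rule: rev_cases) (auto dest: is_nbtw_append_iff[THEN iffD1])

lemma is_nbtw_appendD2: "is_nbtw E (xs @ ys) \<Longrightarrow> ys \<noteq> [] \<Longrightarrow> is_nbtw E ys"
  by (cases ys) (auto dest: is_nbtw_append_iff[THEN iffD1])

lemma is_nbtw_imp_successively: "is_nbtw E xs \<Longrightarrow> successively E xs"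
  by (simp add: is_nbtw_def is_walk_def successively_conv_nth)

lemma is_nbtw_distinct: "successively E xs \<Longrightarrow> distinct xs \<Longrightarrow> xs \<noteq> [] \<Longrightarrow> is_nbtw E xs"
  by (auto simp: is_nbtw_def is_walk_def successively_conv_nth nth_eq_iff_index_eq)

text \<open>The ban on turning back does not mention the edges, so a walk passes to a subgraph as
  soon as its steps lie there.\<close>

lemma is_nbtw_edges:
  "is_nbtw E xs \<longleftrightarrow> is_nbtw (\<lambda>_ _. True) xs \<and> successively E xs"
  by (auto simp: is_nbtw_def is_walk_def successively_conv_nth)

section \<open>Paths extracted from reachability\<close>

lemma successively_rtranclp:
  "successively E (x # xs) \<Longrightarrow> y \<in> set (x # xs) \<Longrightarrow> E\<^sup>*\<^sup>* x y"
proof (induction xs arbitrary: x)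
  case Nil
  then show ?case by simp
next
  case (Cons a xs)
  then show ?case by (metis converse_rtranclp_into_rtranclp rtranclp.rtrancl_refl set_ConsD successively.simps(3))
qed

text \<open>When a vertex is prepended to the path found so far: stop at once if it lies in
  \<open>Z\<close>, and cut the path there if it already occurs on it.\<close>

lemma exists_first_hit_path:
  assumes "R\<^sup>*\<^sup>* y z" "z \<in> Z"
  shows "\<exists>q. successively R (y # q) \<and> distinct (y # q) \<and> last (y # q) \<in> Z \<and>
           set (butlast (y # q)) \<inter> Z = {}"
  using assms
proof (induction rule: converse_rtranclp_induct)
  case base
  then show ?case by (intro exI[of _ "[]"]) auto
next
  case (step y y')
  then obtain q where q: "successively R (y' # q)" "distinct (y' # q)" "last (y' # q) \<in> Z"
    "set (butlast (y' # q)) \<inter> Z = {}" by blast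
  consider "y \<in> Z" | "y \<notin> Z" "y \<in> set (y' # q)" | "y \<notin> Z" "y \<notin> set (y' # q)" by blast
  then show ?case
  proof cases
    case 1
    then show ?thesis by (intro exI[of _ "[]"]) auto
  next
    case 2
    then obtain as bs where *: "y' # q = as @ y # bs" by (meson split_list)
    have "successively R (y # bs)" using q(1) unfolding * by (simp add: successively_append_iff)
    moreover have "distinct (y # bs)" using q(2) unfolding * by simp
    moreover have "last (y # bs) \<in> Z" using q(3) unfolding * by simp
    moreover have "set (butlast (y # bs)) \<inter> Z = {}"
      using q(4) unfolding * butlast_append by auto
    ultimately show ?thesis by blast
  next
    case 3
    then show ?thesis using q step by (intro exI[of _ "y' # q"]) auto
  qed
qed

corollary exists_distinct_path:
  assumes "R\<^sup>*\<^sup>* x y"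
  shows "\<exists>p. successively R (x # p) \<and> distinct (x # p) \<and> last (x # p) = y"
  using exists_first_hit_path[OF assms, of "{y}"] unfolding singleton_iff by blast

section \<open>Cycles\<close>

lemma is_cycle_list_iff:
  "is_cycle_list C U vs \<longleftrightarrow> length vs \<ge> 3 \<and> distinct vs \<and> set vs \<subseteq> C \<and>
     successively U vs \<and> U (last vs) (hd vs)"
  by (simp add: is_cycle_list_def successively_conv_nth)

text \<open>The vertex in front of the longest repetition-free suffix recurs in that suffix, and the
  stretch up to the recurrence closes up. It has at least three vertices: one is excluded by the
  absence of loops, two by non-backtracking.\<close>

lemma nbtw_contains_cycle:
  assumes "is_nbtw U vs" "\<not> distinct vs" "\<And>x. \<not> U x x"
  shows "\<exists>c. is_cycle_list (set vs) U c"
  using assms(1,2)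
proof (induction vs)
  case Nil
  then show ?case by simp
next
  case (Cons x xs)
  show ?case
  proof (cases "distinct xs")
    case False
    have "is_nbtw U xs" using Cons.prems(1) False by (cases xs) (auto simp: is_nbtw_Cons_Cons)
    then show ?thesis using Cons.IH False by (auto simp: is_cycle_list_def)
  next
    case True
    then have "x \<in> set xs" using Cons.prems by simp
    then obtain as bs where *: "xs = as @ x # bs" by (meson split_list)
    have nb: "is_nbtw U (x # as @ [x])"
      using is_nbtw_appendD1[of U "x # as @ [x]" bs] Cons.prems(1) * by simp
    then have s: "successively U (x # as @ [x])" by (rule is_nbtw_imp_successively)
    have "length as \<noteq> 0" using nb assms(3) by (auto simp: is_nbtw_Cons_Cons)
    moreover have "length as \<noteq> Suc 0" using nb
      by (auto simp: is_nbtw_Cons_Cons length_Suc_conv)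
    ultimately have "length as \<ge> 2" by linarith
    moreover have "distinct (x # as)" using True * by auto
    moreover have "successively U (x # as)" "U (last (x # as)) x"
      using s successively_append_iff[of U "x # as" "[x]"] by auto
    ultimately show ?thesis by (intro exI[of _ "x # as"]) (auto simp: is_cycle_list_iff *)
  qed
qed

lemma is_cycle_list_rotate1:
  assumes "is_cycle_list C U vs"
  shows "is_cycle_list C U (rotate1 vs)"
proof -
  obtain a b as where vs: "vs = a # b # as" "as \<noteq> []"
    using assms by (auto simp: is_cycle_list_iff numeral_3_eq_3 Suc_le_length_iff)
  have "successively U ((b # as) @ [a])"
    using assms unfolding vs successively_append_iff by (auto simp: is_cycle_list_iff vs(2))
  then show ?thesis using assms unfolding vs by (auto simp: is_cycle_list_iff)
qed

lemma is_cycle_list_rotate: "is_cycle_list C U vs \<Longrightarrow> is_cycle_list C U (rotate k vs)"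
  by (induction k) (auto intro: is_cycle_list_rotate1)

lemma is_cycle_list_rev:
  assumes "is_cycle_list C U vs" "\<And>x y. U x y \<Longrightarrow> U y x"
  shows "is_cycle_list C U (rev vs)"
proof -
  have "vs \<noteq> []" using assms(1) by (auto simp: is_cycle_list_iff)
  then show ?thesis using assms
    by (auto simp: is_cycle_list_iff hd_rev last_rev intro: successively_mono)
qed

lemma is_cycle_list_class:
  assumes "is_cycle_list C U vs" "\<And>x y. U x y \<Longrightarrow> U y x" "ws \<in> cycle_class vs"
  shows "is_cycle_list C U ws"
  using assms by (auto simp: cycle_class_def intro: is_cycle_list_rotate is_cycle_list_rev)

lemma is_cycle_list_mono:
  "is_cycle_list C U vs \<Longrightarrow> C \<subseteq> C' \<Longrightarrow> (\<And>x y. U x y \<Longrightarrow> U' x y) \<Longrightarrow> is_cycle_list C' U' vs"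
  by (auto simp: is_cycle_list_def)

text \<open>Finiteness matters because \<open>card\<close> of an infinite set is 0; only for a
  finite set does cardinality at most 1 force two cycles to agree.\<close>

lemma finite_cycles: "finite (cycles (C :: 'n::finite set) U)"
proof (rule finite_subset)
  show "cycles C U \<subseteq> cycle_class ` {vs. set vs \<subseteq> UNIV \<and> length vs \<le> CARD('n)}"
  proof
    fix c assume "c \<in> cycles C U"
    then obtain vs where vs: "c = cycle_class vs" "distinct vs"
      by (auto simp only: cycles_def is_cycle_list_def)
    have "length vs \<le> CARD('n)"
      using card_mono[of UNIV "set vs"] vs(2) by (simp add: distinct_card)
    then show "c \<in> cycle_class ` {vs. set vs \<subseteq> UNIV \<and> length vs \<le> CARD('n)}"
      using vs(1) by (intro image_eqI[of _ _ vs]) simp_all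
  qed
qed (intro finite_imageI finite_lists_length_le finite)

section \<open>Cycles up to rotation and reversal\<close>

lemma cycle_class_refl: "vs \<in> cycle_class vs"
  by (auto simp: cycle_class_def intro: exI[of _ 0])

lemma cycle_class_rotate_subset: "cycle_class (rotate k vs) \<subseteq> cycle_class vs"
proof -
  have "\<exists>j. rev (rotate k vs) = rotate j (rev vs)"
    by (metis rev_rev_ident rotate_rev)
  then show ?thesis by (fastforce simp: cycle_class_def rotate_rotate)
qed

lemma cycle_class_rotate [simp]: "cycle_class (rotate k vs) = cycle_class vs"
proof
  \<comment> \<open>Rotating on by the rest of a full turn undoes the rotation.\<close>
  have "\<exists>j. vs = rotate j (rotate k vs)"
  proof (cases "vs = []")
    case False
    have "rotate ((length vs - k mod length vs) + k mod length vs) vs = vs"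
      using False by (simp add: less_imp_le_nat)
    then show ?thesis by (metis rotate_conv_mod rotate_rotate)
  qed simp
  then show "cycle_class vs \<subseteq> cycle_class (rotate k vs)"
    by (metis cycle_class_rotate_subset)
qed (rule cycle_class_rotate_subset)

lemma cycle_class_rev [simp]: "cycle_class (rev vs) = cycle_class vs"
  by (auto simp: cycle_class_def)

lemma undir_adj_sym: "undir_adj E C x y \<Longrightarrow> undir_adj E C y x"
  by (auto simp: undir_adj_def)

lemma undir_adj_irrefl: "\<not> undir_adj E C x x"
  by (simp add: undir_adj_def)

section \<open>Strongly connected components\<close>

lemma scc_classes_reach:
  "C \<in> scc_classes E \<Longrightarrow> x \<in> C \<Longrightarrow> y \<in> C \<Longrightarrow> E\<^sup>*\<^sup>* x y"
  by (auto simp: scc_classes_def intro: rtranclp_trans)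

lemma scc_classes_closed:
  assumes "C \<in> scc_classes E" "x \<in> C" "E\<^sup>*\<^sup>* x y" "E\<^sup>*\<^sup>* y z" "z \<in> C"
  shows "y \<in> C"
  using assms by (auto simp: scc_classes_def intro: rtranclp_trans)

lemma scc_classes_ex: "\<exists>C \<in> scc_classes E. x \<in> C"
  by (auto simp: scc_classes_def intro!: exI[of _ x])

text \<open>If every edge of the undirectization can be traversed both ways, \<open>Y\<close> itself
  is directed. Otherwise some edge runs from \<open>y\<close> to \<open>x\<close> only, and a
  directed path from \<open>x\<close> to \<open>y\<close> closes up with it.\<close>

lemma scc_directed_cycle:
  assumes C: "C \<in> scc_classes E" and Y: "is_cycle_list C (undir_adj E C) Y"
  shows "\<exists>Z. is_cycle_list C E Z"
proof (cases "\<forall>x y. undir_adj E C x y \<longrightarrow> E x y")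
  case True
  then show ?thesis using is_cycle_list_mono[OF Y order_refl] by blast
next
  case False
  then obtain x y where xy: "x \<in> C" "y \<in> C" "x \<noteq> y" "\<not> E x y" "E y x"
    by (auto simp: undir_adj_def)
  obtain p where p: "successively E (x # p)" "distinct (x # p)" "last (x # p) = y"
    using exists_distinct_path scc_classes_reach[OF C xy(1,2)] by metis
  \<comment> \<open>As \<open>E x y\<close> fails, the path has an inner vertex, so the cycle has at
    least three vertices.\<close>
  obtain a b p' where p': "p = a # b # p'"
  proof (cases p)
    case Nil
    then show ?thesis using p(3) xy(3) by simp
  next
    case (Cons a as)
    then show ?thesis using p xy that by (cases as) auto
  qed
  have "w \<in> C" if w: "w \<in> set (x # p)" for w
  proof -
    obtain as bs where *: "x # p = as @ w # bs" using split_list[OF w] by blast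
    have "successively E (w # bs)" using p(1) unfolding * by (simp add: successively_append_iff)
    moreover have "last (w # bs) = y" using p(3) unfolding * by simp
    ultimately have "E\<^sup>*\<^sup>* w y"
      by (metis last_in_set list.distinct(1) successively_rtranclp)
    then show ?thesis
      using scc_classes_closed[OF C xy(1) _ _ xy(2)] successively_rtranclp[OF p(1) w] by blast
  qed
  then have "is_cycle_list C E (x # p)"
    unfolding is_cycle_list_iff using p xy(5) p' by auto
  then show ?thesis by blast
qed

section \<open>Exponential growth\<close>

definition nb_count :: "('n \<Rightarrow> 'n \<Rightarrow> bool) \<Rightarrow> nat \<Rightarrow> real" where
  "nb_count E k = real (card {vs. length vs = Suc k \<and> is_nbtw E vs})"

text \<open>Indexed by an initial edge, since the last edge of a walk, not its last vertex alone,
  decides which continuations are non-backtracking.\<close>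

definition nb_ext :: "('n \<Rightarrow> 'n \<Rightarrow> bool) \<Rightarrow> 'n \<Rightarrow> 'n \<Rightarrow> nat \<Rightarrow> 'n list set" where
  "nb_ext E u v k = {vs. length vs = k \<and> is_nbtw E (u # v # vs)}"

lemma finite_length_eq: "finite {vs :: 'n::finite list. length vs = k \<and> P vs}"
  by (rule finite_subset[OF _ finite_lists_length_eq[of UNIV k]]) auto

lemma finite_nb_ext [simp]: "finite (nb_ext E u v k :: 'n::finite list set)"
  unfolding nb_ext_def by (rule finite_length_eq)

lemma nb_count_nonneg: "0 \<le> nb_count E k"
  by (simp add: nb_count_def)

lemma card_nb_ext_le: "real (card (nb_ext E u v k)) \<le> nb_count (E :: 'n::finite \<Rightarrow> _) (Suc k)"
proof -
  have "card ((\<lambda>vs. u # v # vs) ` nb_ext E u v k) \<le> card {vs. length vs = Suc (Suc k) \<and> is_nbtw E vs}"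
    by (rule card_mono[OF finite_length_eq]) (auto simp: nb_ext_def)
  then show ?thesis by (simp add: nb_count_def card_image inj_on_def)
qed

lemma conv_radius_less_1_if_doubling:
  fixes E :: "'n::finite \<Rightarrow> 'n \<Rightarrow> bool"
  assumes "L > 0" and dbl: "\<And>k. 2 * card (nb_ext E u v k) \<le> card (nb_ext E u v (k + L))" and "E u v"
  shows "conv_radius (nb_count E) < 1"
proof -
  have pow: "2 ^ k \<le> card (nb_ext E u v (k * L))" for k
  proof (induction k)
    case 0
    have "nb_ext E u v 0 = {[]}" using assms(3) by (auto simp: nb_ext_def is_nbtw_Cons_Cons)
    then show ?case by simp
  next
    case (Suc k)
    then show ?case using dbl[of "k * L"] by (simp add: add.commute)
  qed
  \<comment> \<open>With \<open>t ^ L = 1/2\<close> the factor \<open>t ^ (k * L)\<close> cancels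
    the growth \<open>2 ^ k\<close>, so the terms of index \<open>Suc (k * L)\<close> are at least
    \<open>t\<close>.\<close>
  define t :: real where "t = root L (1/2)"
  have t: "0 < t" "t < 1" "t ^ L = 1/2"
    using \<open>L > 0\<close> by (simp_all add: t_def real_root_pow_pos2)
  have ge: "t \<le> nb_count E (Suc (k * L)) * t ^ Suc (k * L)" for k
  proof -
    have "t = t * (2 ^ k * (1/2) ^ k)" by (simp add: power_mult_distrib[symmetric])
    also have "(1/2) ^ k = t ^ (k * L)" by (metis t(3) power_mult mult.commute)
    also have "2 ^ k \<le> nb_count E (Suc (k * L))"
      using card_nb_ext_le[of E u v "k * L"] pow[of k]
      by (metis numeral_power_le_of_nat_cancel_iff order_trans)
    finally show ?thesis using t(1) by (simp add: mult.commute mult.left_commute mult_left_mono)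
  qed
  have "\<not> summable (\<lambda>n. nb_count E n * t ^ n)"
  proof
    assume "summable (\<lambda>n. nb_count E n * t ^ n)"
    then have "(\<lambda>n. nb_count E n * t ^ n) \<longlonglongrightarrow> 0" by (rule summable_LIMSEQ_zero)
    moreover have "filterlim (\<lambda>k. Suc (k * L)) at_top at_top"
      using \<open>L > 0\<close> by (intro filterlim_subseq) (simp add: strict_mono_def)
    ultimately have "(\<lambda>k. nb_count E (Suc (k * L)) * t ^ Suc (k * L)) \<longlonglongrightarrow> 0"
      by (rule filterlim_compose)
    then have "0 \<ge> t" using ge by (intro tendsto_lowerbound[where F = sequentially]) auto
    then show False using t by simp
  qed
  then have "conv_radius (nb_count E) \<le> norm t" by (rule conv_radius_leI')
  also have "\<dots> < 1" using t by simp
  finally show ?thesis .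
qed

text \<open>Both loops return to the edge from \<open>u\<close> to \<open>v\<close>, so they can be
  composed freely. Prefixing a continuation by \<open>X @ Y\<close> and by \<open>Y @ X\<close>
  gives equal lengths, and the results differ in their first vertex.\<close>

lemma two_loops_doubling:
  fixes E :: "'n::finite \<Rightarrow> 'n \<Rightarrow> bool"
  assumes X: "is_nbtw E (u # v # X)" "u # v # X = X' @ [u, v]"
    and Y: "is_nbtw E (u # v # Y)" "u # v # Y = Y' @ [u, v]"
    and ne: "X \<noteq> []" "Y \<noteq> []" "hd X \<noteq> hd Y"
  shows "2 * card (nb_ext E u v k) \<le> card (nb_ext E u v (k + (length X + length Y)))"
proof -
  have glueX: "is_nbtw E (u # v # X @ r)" if "is_nbtw E (u # v # r)" for r
    using is_nbtw_overlap[of E X' u v r] X that by (metis append.assoc append_Cons append_Nil)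
  have glueY: "is_nbtw E (u # v # Y @ r)" if "is_nbtw E (u # v # r)" for r
    using is_nbtw_overlap[of E Y' u v r] Y that by (metis append.assoc append_Cons append_Nil)
  let ?f = "\<lambda>r. X @ Y @ r" and ?g = "\<lambda>r. Y @ X @ r" and ?A = "nb_ext E u v k"
  have "?f ` ?A \<inter> ?g ` ?A = {}" using ne by (auto dest!: arg_cong[where f = hd])
  then have "card (?f ` ?A \<union> ?g ` ?A) = card ?A + card ?A"
    by (subst card_Un_disjoint) (auto simp: card_image inj_on_def)
  moreover have "?f ` ?A \<union> ?g ` ?A \<subseteq> nb_ext E u v (k + (length X + length Y))"
    by (auto simp: nb_ext_def intro!: glueX glueY)
  ultimately show ?thesis using card_mono[OF finite_nb_ext] by (metis mult_2)
qed

section \<open>Winding around a directed cycle, read as a periodic sequence\<close>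

context
  fixes E :: "'n::finite \<Rightarrow> 'n \<Rightarrow> bool" and C Z and z :: "nat \<Rightarrow> 'n"
  assumes Z: "is_cycle_list C E Z"
  defines "z \<equiv> \<lambda>i. Z ! (i mod length Z)"
begin

lemma cycle_step: "E (z i) (z (Suc i))"
proof (cases "Suc (i mod length Z) < length Z")
  case True
  then show ?thesis using Z by (simp add: z_def is_cycle_list_def mod_Suc)
next
  case False
  have "Z \<noteq> []" using Z by (auto simp: is_cycle_list_def)
  then have "Suc (i mod length Z) = length Z"
    by (metis False Suc_lessI length_greater_0_conv mod_less_divisor)
  then have "i mod length Z = length Z - 1" "Suc i mod length Z = 0"
    by (simp_all add: mod_Suc)
  then show ?thesis using Z \<open>Z \<noteq> []\<close>
    by (simp add: z_def is_cycle_list_def last_conv_nth hd_conv_nth)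
qed

lemma cycle_eq_iff: "z i = z j \<longleftrightarrow> i mod length Z = j mod length Z"
proof -
  have "Z \<noteq> []" "distinct Z" using Z by (auto simp: is_cycle_list_def)
  then show ?thesis by (simp add: z_def nth_eq_iff_index_eq)
qed

lemma cycle_walk_nbtw:
  assumes "a < b"
  shows "is_nbtw E (map z [a..<b])"
proof -
  have "z (i + 2) \<noteq> z i" for i
  proof
    assume "z (i + 2) = z i"
    then have "length Z dvd 2" by (simp add: cycle_eq_iff mod_eq_dvd_iff_nat)
    then show False using Z dvd_imp_le[of "length Z" 2] by (simp add: is_cycle_list_def)
  qed
  then show ?thesis using assms cycle_step by (auto simp: is_nbtw_def is_walk_def)
qed

text \<open>There are two loops at the edge from the predecessor of \<open>z i\<close> to
  \<open>z i\<close>: one turn around \<open>Z\<close>, and the detour \<open>p\<close> followed by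
  \<open>Z\<close> from \<open>z j\<close> on. The conditions \<open>out\<close> make the loops
  differ in their first step and keep the detour from turning back; \<open>ret\<close> prevents
  turning back where the walk resumes on \<open>Z\<close>. Prefixing \<open>z i\<close> in
  \<open>ret\<close> covers a chord, for which \<open>butlast p\<close> is empty.\<close>

lemma detour_conv_radius_less_1:
  assumes p: "is_nbtw E (z i # p)" "p \<noteq> []" "last p = z j"
    and out: "hd p \<noteq> z (i + 1)" "hd p \<noteq> z (i + length Z - 1)"
    and ret: "last (butlast (z i # p)) \<noteq> z (j + 1)"
  shows "conv_radius (nb_count E) < 1"
proof -
  define m where "m = length Z"
  have m: "m \<ge> 3" using Z by (simp add: is_cycle_list_def m_def)
  have per: "z (k + l * m) = z k" for k l by (simp add: z_def m_def)
  \<comment> \<open>Shifts by full turns: \<open>a - 1\<close> is a true predecessor, where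
    \<open>i - 1\<close> would truncate at 0, and \<open>b\<close> is a copy of \<open>i\<close>
    beyond \<open>j\<close>.\<close>
  define a where "a = i + m"
  define b where "b = a + m * (j + 1)"
  have "j < m * (j + 1)" using m by (induction j) auto
  then have "j < b" by (simp add: b_def)
  have za: "z a = z i" "z (a + m) = z i" "z (a + 1) = z (i + 1)" 
    using per[of i 1] per[of i 2] per[of "i+1" 1] by (simp_all add: a_def add_ac mult_2)
  have "z (a + m - 1) = z (a - 1)" using per[of "a - 1" 1] m by (simp add: a_def add_ac)
  note za = za this
  have zb: "z b = z i" "z (b - 1) = z (a - 1)"
    using per[of i "j + 2"] per[of "a - 1" "j + 1"] m
    by (simp_all add: a_def b_def algebra_simps)
  define u v where "u = z (a - 1)" and "v = z i"
  define X where "X = map z [a + 1..<a + m + 1]"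
  define Y where "Y = p @ map z [j + 1..<b + 1]"
  have a1: "a \<ge> 1" "Suc (a - 1) = a" using m by (simp_all add: a_def)
  have X_eq: "u # v # X = map z [a - 1..<a + m + 1]"
    using a1 by (simp add: u_def v_def X_def upt_conv_Cons za)
  have upt2: "map z [c..<d + 1] = map z [c..<d - 1] @ [z (d - 1), z d]" if "c < d" for c d
  proof -
    obtain e where "d = Suc e" using \<open>c < d\<close> less_imp_Suc_add by blast
    then show ?thesis using that by simp
  qed
  have X1: "u # v # X = map z [a - 1..<a + m - 1] @ [u, v]"
    unfolding X_eq using upt2[of "a - 1" "a + m"] a1 za by (simp add: u_def v_def)
  have X2: "is_nbtw E (u # v # X)"
    unfolding X_eq by (rule cycle_walk_nbtw) simp
  have X3: "X \<noteq> []" "hd X = z (i + 1)"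
    using m za by (simp_all add: X_def hd_map)
  \<comment> \<open>The vertex \<open>last p = z j\<close> is moved over to the stretch along the
    cycle.\<close>
  have bl: "u # v # Y = (u # v # butlast p) @ map z [j..<b + 1]"
    using p(2,3) \<open>j < b\<close> append_butlast_last_id[OF p(2)] by (simp add: Y_def upt_conv_Cons)
  have Y1: "u # v # Y = (u # v # butlast p @ map z [j..<b - 1]) @ [u, v]"
    unfolding bl using upt2[OF \<open>j < b\<close>] zb by (simp add: u_def v_def)
  have Y2: "is_nbtw E (u # v # Y)"
  proof -
    have "E u v" using cycle_step[of "a - 1"] a1 za by (simp add: u_def v_def)
    moreover have "u = z (i + m - 1)" by (simp add: u_def a_def)
    ultimately have "is_nbtw E (u # v # p)"
      using p(1) out(2) by (auto simp: v_def m_def is_nbtw_Cons_Cons)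
    then have "is_nbtw E ((u # v # butlast p) @ [z j])"
      using append_butlast_last_id[OF p(2)] p(3) by simp
    moreover have "is_nbtw E (z j # map z [j + 1..<b + 1])"
      using cycle_walk_nbtw[of j "b + 1"] \<open>j < b\<close> by (simp add: upt_conv_Cons)
    moreover have "last (u # v # butlast p) \<noteq> hd (map z [j + 1..<b + 1])"
      using ret \<open>j < b\<close> p(2) by (simp add: v_def hd_map del: upt_Suc)
    ultimately show ?thesis
      unfolding bl using \<open>j < b\<close>
      using is_nbtw_append_iff[of E "u # v # butlast p" "z j" "map z [j + 1..<b + 1]"]
      by (simp add: upt_conv_Cons del: upt_Suc)
  qed
  have Y3: "Y \<noteq> []" "hd Y = hd p" using p(2) by (simp_all add: Y_def)
  have "2 * card (nb_ext E u v k) \<le> card (nb_ext E u v (k + (length X + length Y)))" for k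
    using two_loops_doubling[OF X2 X1 Y2 Y1 X3(1) Y3(1)] X3(2) Y3(2) out(1) by metis
  moreover have "E u v" using cycle_step[of "a - 1"] a1 za by (simp add: u_def v_def)
  moreover have "length X + length Y > 0" using X3 by simp
  ultimately show ?thesis by (rule conv_radius_less_1_if_doubling[rotated])
qed

end

section \<open>Trees hanging off a cycle\<close>

text \<open>The list \<open>q\<close> omits the start, so it is empty exactly when \<open>y\<close>
  lies in \<open>Z\<close>. The relation is a parameter because paths along \<open>E\<close> and
  along its converse are compared.\<close>

definition path_into :: "'n set \<Rightarrow> ('n \<Rightarrow> 'n \<Rightarrow> bool) \<Rightarrow> 'n \<Rightarrow> 'n list \<Rightarrow> bool" where
  "path_into Z R y q \<longleftrightarrow> is_nbtw R (y # q) \<and> last (y # q) \<in> Z \<and> set (butlast (y # q)) \<inter> Z = {}"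

lemma path_into_Cons:
  "y \<notin> Z \<Longrightarrow> path_into Z R y q \<longleftrightarrow>
     (\<exists>x q'. q = x # q' \<and> R y x \<and> path_into Z R x q' \<and> (q' \<noteq> [] \<longrightarrow> hd q' \<noteq> y))"
  by (cases q) (auto simp: path_into_def is_nbtw_Cons_Cons)

lemma path_into_Nil: "y \<in> Z \<Longrightarrow> path_into Z R y q \<longleftrightarrow> q = []"
  by (cases q) (auto simp: path_into_def)

lemma path_into_exists:
  assumes "R\<^sup>*\<^sup>* y z" "z \<in> Z"
  shows "\<exists>q. path_into Z R y q"
  using exists_first_hit_path[OF assms] is_nbtw_distinct unfolding path_into_def by blast

text \<open>At the first difference the two paths would combine to a detour.\<close>

lemma path_into_unique:
  assumes nodetour: "\<And>z p. z \<in> Z \<Longrightarrow> is_nbtw E (z # p) \<Longrightarrow> length p \<ge> 2 \<Longrightarrow> last p \<in> Z \<Longrightarrow>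
      set (butlast p) \<inter> Z = {} \<Longrightarrow> False"
    and "path_into Z (\<lambda>a b. E b a) y p" "path_into Z E y q"
  shows "p = q"
  using assms(2,3)
proof (induction p arbitrary: y q)
  case Nil
  then have "y \<in> Z" by (simp add: path_into_def)
  show ?case using Nil.prems(2) path_into_Nil[OF \<open>y \<in> Z\<close>, of E q] by simp
next
  case (Cons x p)
  have "y \<notin> Z" using Cons.prems(1) path_into_Nil[of y Z _ "x # p"] by blast
  then obtain x' q' where q: "q = x' # q'" "path_into Z E x' q'"
    using Cons.prems(2) path_into_Cons[OF \<open>y \<notin> Z\<close>, of E q] by blast
  have px: "path_into Z (\<lambda>a b. E b a) x p"
    using Cons.prems(1) path_into_Cons[OF \<open>y \<notin> Z\<close>, of "\<lambda>a b. E b a" "x # p"] by blast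
  have "x = x'"
  proof (rule ccontr)
    assume "x \<noteq> x'"
    have 1: "is_nbtw E (rev (x # p) @ [y])"
      using Cons.prems(1) is_nbtw_rev[of E "y # x # p"] by (simp add: path_into_def)
    have 2: "is_nbtw E (y # q)" using Cons.prems(2) by (simp add: path_into_def)
    \<comment> \<open>Reversed, the converse path runs along \<open>E\<close> from \<open>Z\<close>
      to \<open>y\<close>. It arrives from \<open>x\<close>, so leaving towards \<open>x'\<close>
      does not backtrack.\<close>
    have nb: "is_nbtw E (rev (x # p) @ y # q)"
      using is_nbtw_append_iff[of E "rev (x # p)" y q] 1 2 \<open>x \<noteq> x'\<close> q by simp
    obtain r z where r: "x # p = r @ [z]" by (metis list.distinct(1) rev_exhaust)
    then have z: "z \<in> Z" "set r \<inter> Z = {}" using px by (auto simp: path_into_def)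
    show False
    proof (rule nodetour[OF z(1)])
      show "is_nbtw E (z # rev r @ y # q)" using nb unfolding r by simp
      show "length (rev r @ y # q) \<ge> 2" using q by simp
      show "last (rev r @ y # q) \<in> Z" using Cons.prems(2) by (simp add: path_into_def)
      show "set (butlast (rev r @ y # q)) \<inter> Z = {}"
        using z(2) Cons.prems(2) unfolding path_into_def butlast_append by auto
    qed
  qed
  then show ?case using Cons.IH px q by simp
qed

text \<open>Without detours every vertex off the cycle has a unique path into the cycle, and every
  edge at such a vertex joins it to its parent or to a child. At a vertex of maximal depth a
  cycle would have to use the parent edge twice.\<close>

lemma no_detour_cycles_subset:
  fixes E :: "'n \<Rightarrow> 'n \<Rightarrow> bool"
  assumes C: "C \<in> scc_classes E" and Z: "Z \<noteq> {}" "Z \<subseteq> C"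
    and nodetour: "\<And>z p. z \<in> Z \<Longrightarrow> is_nbtw E (z # p) \<Longrightarrow> length p \<ge> 2 \<Longrightarrow> last p \<in> Z \<Longrightarrow>
      set (butlast p) \<inter> Z = {} \<Longrightarrow> False"
    and Y: "is_cycle_list C (undir_adj E C) Y"
  shows "set Y \<subseteq> Z"
proof (rule ccontr)
  assume off: "\<not> set Y \<subseteq> Z"
  let ?E' = "\<lambda>a b. E b a"
  obtain z where z: "z \<in> Z" "z \<in> C" using Z by blast
  have uniq: "p = q" if "path_into Z ?E' y p" "path_into Z E y q" for y p q
    using path_into_unique[OF nodetour that] .
  \<comment> \<open>Uniqueness holds across the two directions, so one \<open>f\<close> serves both
    \<open>E\<close> and its converse.\<close>
  have ex: "\<exists>f. path_into Z E y f \<and> path_into Z ?E' y f" if "y \<in> C" for y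
  proof -
    have "E\<^sup>*\<^sup>* y z" "E\<^sup>*\<^sup>* z y" using scc_classes_reach[OF C] z that by auto
    moreover have "?E' = E\<inverse>\<inverse>" by (auto simp: fun_eq_iff)
    ultimately have "?E'\<^sup>*\<^sup>* y z" by (simp add: rtranclp_converseI)
    then obtain p where p: "path_into Z ?E' y p" using path_into_exists[OF _ z(1)] by blast
    obtain q where q: "path_into Z E y q"
      using path_into_exists[OF \<open>E\<^sup>*\<^sup>* y z\<close> z(1)] by blast
    show ?thesis using p q uniq[OF p q] by auto
  qed
  then obtain f where f: "\<And>y. y \<in> C \<Longrightarrow> path_into Z E y (f y)"
    "\<And>y. y \<in> C \<Longrightarrow> path_into Z ?E' y (f y)" by metis
  have f_eq: "q = f y" if "path_into Z R y q" "R = E \<or> R = ?E'" "y \<in> C" for R y q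
    using that(1,2) uniq[of y q "f y"] uniq[of y "f y" q] f[OF that(3)] by auto
  \<comment> \<open>Unless the path of \<open>x\<close> begins with a step to \<open>y\<close>,
    prefixing \<open>x\<close> to it yields the path of \<open>y\<close>; otherwise \<open>x\<close>
    is a child of \<open>y\<close>.\<close>
  have nbr: "f y = x # f x \<or> f x = y # f y" if "y \<in> C" "x \<in> C" "y \<notin> Z" "R y x" "R = E \<or> R = ?E'" for R x y
  proof (cases "f x \<noteq> [] \<and> hd (f x) = y")
    case True
    then obtain r where r: "f x = y # r" by (metis list.collapse)
    have "x \<notin> Z" using f(1)[OF that(2)] r path_into_Nil[of x Z E "f x"] by auto
    then have "path_into Z E y r" using f(1)[OF that(2)] r path_into_Cons[of x Z E "y # r"] by auto
    then show ?thesis using f_eq[OF _ _ that(1), of E r] r by simp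
  next
    case False
    then have "path_into Z R y (x # f x)"
      using that f[OF that(2)] path_into_Cons[OF that(3), of R "x # f x"] by auto
    then show ?thesis using f_eq[OF _ that(5,1)] by auto
  qed
  have YC: "set Y \<subseteq> C" using Y by (simp add: is_cycle_list_def)
  obtain y where y: "y \<in> set Y" "y \<notin> Z"
    and max: "\<And>x. x \<in> set Y \<Longrightarrow> x \<notin> Z \<Longrightarrow> length (f x) \<le> length (f y)"
  proof -
    let ?N = "(\<lambda>x. length (f x)) ` (set Y - Z)"
    have fin: "finite ?N" "?N \<noteq> {}" using off by auto
    obtain y where y: "y \<in> set Y - Z" "Max ?N = length (f y)"
      using Max_in[OF fin] by auto
    show ?thesis
    proof (rule that[of y])
      fix x assume "x \<in> set Y" "x \<notin> Z"
      then show "length (f x) \<le> length (f y)"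
        unfolding y(2)[symmetric] by (intro Max_ge[OF fin(1)]) auto
    qed (use y in auto)
  qed
  \<comment> \<open>A child of \<open>y\<close> would have a longer path, against maximality; a
    vertex of \<open>Z\<close> has the empty path and is no child.\<close>
  have parent: "hd (f y) = x" if "x \<in> set Y" "undir_adj E C y x" for x
  proof -
    have "f y = x # f x \<or> f x = y # f y"
      using that(2) nbr[of y x E] nbr[of y x ?E'] y(2) by (auto simp: undir_adj_def)
    moreover have "f x = []" if "x \<in> Z"
      using that f(1)[of x] \<open>x \<in> set Y\<close> YC path_into_Nil[OF that, of E "f x"] by blast
    ultimately show ?thesis using max[OF that(1)] by (cases "x \<in> Z") auto
  qed
  obtain i where i: "i < length Y" "y = Y ! i" using y(1) by (metis in_set_conv_nth)
  define W where "W = rotate i Y"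
  have W: "is_cycle_list C (undir_adj E C) W" using is_cycle_list_rotate[OF Y] by (simp add: W_def)
  then obtain a b w where w: "W = a # b # w" "w \<noteq> []"
    by (auto simp: is_cycle_list_def numeral_3_eq_3 Suc_le_length_iff)
  have "a = y" using w(1) i hd_rotate_conv_nth[of Y i] y(1) by (cases Y) (auto simp: W_def)
  have "set W = set Y" by (simp add: W_def)
  have "hd (f y) = b"
    using parent[of b] W \<open>set W = set Y\<close> \<open>a = y\<close> by (auto simp: is_cycle_list_iff w)
  moreover have "hd (f y) = last w"
  proof (rule parent)
    show "last w \<in> set Y" unfolding \<open>set W = set Y\<close>[symmetric] w(1) using w(2) by simp
    have "undir_adj E C (last w) y"
      using W w(2) unfolding w(1) \<open>a = y\<close> by (simp add: is_cycle_list_iff)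
    then show "undir_adj E C y (last w)" by (rule undir_adj_sym)
  qed
  ultimately show False using W w by (auto simp: is_cycle_list_iff)
qed

text \<open>Once two consecutive vertices agree, \<open>Y\<close> is forced along \<open>Z\<close>:
  a vertex is adjacent only to its two cyclic neighbours, and the preceding one is used up.\<close>

lemma cycle_in_chordless_cycle:
  assumes Z: "length Z \<ge> 3" "distinct Z"
    and Y: "is_cycle_list (set Z) U Y" and start: "hd Y = hd Z" "Y ! 1 = Z ! 1"
    and chordless: "\<And>i j. i < length Z \<Longrightarrow> j < length Z \<Longrightarrow> U (Z ! i) (Z ! j) \<Longrightarrow>
      j = Suc i mod length Z \<or> i = Suc j mod length Z"
  shows "Y = Z"
proof -
  have Y': "length Y \<ge> 3" "distinct Y" "set Y \<subseteq> set Z" "\<And>r. Suc r < length Y \<Longrightarrow> U (Y ! r) (Y ! Suc r)"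
    "U (last Y) (hd Y)" using Y by (auto simp: is_cycle_list_def)
  have le: "length Y \<le> length Z"
    using card_mono[OF _ Y'(3)] Y'(2) Z(2) by (simp add: distinct_card)
  have eq: "Y ! r = Z ! r" if "r < length Y" for r
    using that
  proof (induction r rule: less_induct)
    case (less r)
    consider "r = 0" | "r = 1" | q where "r = Suc (Suc q)"
      by (metis One_nat_def not0_implies_Suc)
    then show ?case
    proof cases
      case 1
      then show ?thesis using start(1) Y'(1) Z(1) by (cases Y; cases Z) auto
    next
      case 2
      then show ?thesis using start by simp
    next
      case 3
      have "Y ! r \<in> set Z" using Y'(3) less.prems by auto
      then obtain j where j: "j < length Z" "Y ! r = Z ! j" by (metis in_set_conv_nth)
      have "U (Z ! Suc q) (Z ! j)"
        using Y'(4)[of "Suc q"] less 3 j by simp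
      then have "j = Suc (Suc q) mod length Z \<or> Suc q = Suc j mod length Z"
        using chordless[of "Suc q" j] less.prems 3 le j(1) by simp
      moreover have "j \<noteq> q"
      proof
        assume "j = q"
        then have "Y ! r = Y ! q" using less j 3 by simp
        then show False using Y'(2) less.prems 3 by (simp add: nth_eq_iff_index_eq)
      qed
      ultimately have "j = r" using 3 less.prems le j(1)
        by (auto simp: mod_Suc split: if_splits)
      then show ?thesis using j by simp
    qed
  qed
  \<comment> \<open>A shorter \<open>Y\<close> would close up by an edge from its end to
    \<open>Z ! 0\<close>, which is a chord.\<close>
  have "length Y = length Z"
  proof (rule ccontr)
    assume "length Y \<noteq> length Z"
    then have lt: "length Y < length Z" using le by simp
    have "last Y = Z ! (length Y - 1)" "hd Y = Z ! 0"
      using eq[of "length Y - 1"] Y'(1) start Z(1) by (cases Y, auto simp: last_conv_nth hd_conv_nth)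
         (metis hd_conv_nth list.size(3) not_numeral_le_zero)
    then show False using chordless[of "length Y - 1" 0] Y'(1,5) lt
      by (cases "length Y"; cases "length Z") (auto simp: mod_Suc split: if_splits)
  qed
  then show ?thesis using eq by (simp add: nth_equalityI)
qed

text \<open>The two neighbours of the start vertex in \<open>Y\<close> are distinct and both are its
  neighbours in \<open>Z\<close>, so \<open>Y\<close> or its reversal starts along
  \<open>Z\<close>.\<close>

lemma cycle_class_eq_chordless:
  assumes Z: "length Z \<ge> 3" "distinct Z"
    and Y: "is_cycle_list C U Y" "set Y \<subseteq> set Z" "hd Y = hd Z"
    and sym: "\<And>x y. U x y \<Longrightarrow> U y x"
    and chordless: "\<And>i j. i < length Z \<Longrightarrow> j < length Z \<Longrightarrow> U (Z ! i) (Z ! j) \<Longrightarrow>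
      j = Suc i mod length Z \<or> i = Suc j mod length Z"
  shows "cycle_class Y = cycle_class Z"
proof -
  obtain a b w where w: "Y = a # b # w" "w \<noteq> []"
    using Y(1) by (auto simp: is_cycle_list_def numeral_3_eq_3 Suc_le_length_iff)
  \<comment> \<open>The reversal of \<open>Y\<close>, rotated so as to start at \<open>a\<close>
    again.\<close>
  define Y' where "Y' = a # rev w @ [b]"
  have "rotate1 Y' = rev Y" by (simp add: Y'_def w)
  have "is_cycle_list (set Z) U Y" using Y(1,2) by (simp add: is_cycle_list_def)
  have "rev (rotate1 Y) = Y'" by (simp add: Y'_def w)
  then have Y': "is_cycle_list (set Z) U Y'"
    using is_cycle_list_rev[OF is_cycle_list_rotate1 sym, OF \<open>is_cycle_list (set Z) U Y\<close>] by simp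
  have nbr: "x = Z ! 1 \<or> x = last Z" if x: "U a x" "x \<in> set Z" for x
  proof -
    obtain j where j: "j < length Z" "x = Z ! j" using x(2) by (metis in_set_conv_nth)
    have "Z \<noteq> []" using Z by auto
    then have "a = Z ! 0" using Y(3) w by (simp add: hd_conv_nth)
    then have "j = 1 \<or> 0 = Suc j mod length Z"
      using chordless[of 0 j] j x(1) Z(1) \<open>Z \<noteq> []\<close> by auto
    moreover have "j = length Z - 1" if "0 = Suc j mod length Z"
      using that j(1) by (simp add: mod_Suc split: if_splits)
    ultimately show ?thesis using j(2) \<open>Z \<noteq> []\<close> by (auto simp: last_conv_nth)
  qed
  have "b = Z ! 1 \<or> b = last Z"
    using nbr[of b] Y(1,2) by (simp add: w is_cycle_list_iff)
  moreover have "last w = Z ! 1 \<or> last w = last Z"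
  proof (rule nbr)
    show "U a (last w)" using Y(1) w by (intro sym[of "last w"]) (simp add: is_cycle_list_iff)
    show "last w \<in> set Z" using Y(2) w by auto
  qed
  moreover have "b \<noteq> last w" using Y(1) w by (auto simp: is_cycle_list_iff)
  ultimately consider "Y ! 1 = Z ! 1" | "Y' ! 1 = Z ! 1"
    using w by (auto simp: Y'_def nth_append hd_conv_nth[symmetric] hd_rev)
  then show ?thesis
  proof cases
    case 1
    then show ?thesis
      using cycle_in_chordless_cycle[OF Z \<open>is_cycle_list (set Z) U Y\<close> Y(3) 1 chordless] by simp
  next
    case 2
    have "hd Y' = hd Z" using Y(3) by (simp add: Y'_def w)
    then have "Y' = Z" using cycle_in_chordless_cycle[OF Z Y' _ 2 chordless] by simp
    have "cycle_class Y = cycle_class (rotate1 Y')"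
      unfolding \<open>rotate1 Y' = rev Y\<close> by simp
    also have "\<dots> = cycle_class Z"
      using cycle_class_rotate[of 1 Y'] \<open>Y' = Z\<close> by simp
    finally show ?thesis .
  qed
qed

text \<open>By contradiction: without exponential growth the directed cycle \<open>Z\<close> has
  neither an outside detour nor a chord. The first puts every cycle on \<open>Z\<close>, the second
  makes it a rotation or reversal of \<open>Z\<close>.\<close>

theorem scc_two_cycles_conv_radius:
  fixes E :: "'n::finite \<Rightarrow> 'n \<Rightarrow> bool"
  assumes C: "C \<in> scc_classes E" and two: "card (cycles C (undir_adj E C)) > 1"
  shows "conv_radius (nb_count E) < 1"
proof (rule ccontr)
  assume growth: "\<not> ?thesis"
  let ?U = "undir_adj E C"
  have "cycles C ?U \<noteq> {}" using two by auto
  then obtain Z where Z: "is_cycle_list C E Z"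
    using scc_directed_cycle[OF C] by (auto simp: cycles_def)
  have Z': "length Z \<ge> 3" "distinct Z" "set Z \<subseteq> C" using Z by (auto simp: is_cycle_list_def)
  have outside: "Z ! (k mod length Z) \<in> set Z" for k
    using Z'(1) by (intro nth_mem mod_less_divisor) linarith
  have nodetour: False
    if p0: "x \<in> set Z" "is_nbtw E (x # p)" "length p \<ge> 2" "last p \<in> set Z" "set (butlast p) \<inter> set Z = {}"
    for x p
  proof -
    obtain i where i: "i < length Z" "x = Z ! i" using p0(1) by (metis in_set_conv_nth)
    obtain j where j: "j < length Z" "last p = Z ! j" using p0(4) by (metis in_set_conv_nth)
    have "length (butlast p) \<noteq> 0" using p0(3) by simp
    then have "butlast p \<noteq> []" by (metis list.size(3))
    moreover from this have "p \<noteq> []" by auto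
    ultimately have p: "butlast p \<noteq> []" "p \<noteq> []" "p = butlast p @ [last p]" by simp_all
    have "hd p = hd (butlast p)" using p by (metis hd_append2)
    then have q: "hd p \<notin> set Z" "last (butlast (x # p)) \<notin> set Z"
      using p0(5) p(2) hd_in_set[OF p(1)] last_in_set[OF p(1)] p(1) by (auto simp: disjoint_iff)
    \<comment> \<open>The first vertex of \<open>p\<close> and the last one before the return lie
      off \<open>Z\<close>, so they differ from all cyclic neighbours.\<close>
    have "conv_radius (nb_count E) < 1"
    proof (rule detour_conv_radius_less_1[OF Z, of i p j])
      show "is_nbtw E (Z ! (i mod length Z) # p)" "p \<noteq> []" "last p = Z ! (j mod length Z)"
        using p0(2) i j p by simp_all
      show "hd p \<noteq> Z ! ((i + 1) mod length Z)" "hd p \<noteq> Z ! ((i + length Z - 1) mod length Z)"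
        using q(1) outside by metis+
      show "last (butlast (Z ! (i mod length Z) # p)) \<noteq> Z ! ((j + 1) mod length Z)"
        using q(2) outside i by (metis mod_less)
    qed
    then show False using growth by simp
  qed
  have "cycle_class Y = cycle_class Z" if Y: "is_cycle_list C ?U Y" for Y
  proof -
    have sub: "set Y \<subseteq> set Z"
      by (rule no_detour_cycles_subset[OF C _ Z'(3) nodetour Y]) (use Z'(1) in auto)
    have "Y \<noteq> []" using Y by (auto simp: is_cycle_list_def)
    then obtain i where i: "i < length Z" "hd Y = Z ! i"
      using sub by (metis hd_in_set in_set_conv_nth subsetD)
    \<comment> \<open>\<open>Z\<close> is turned so as to start where \<open>Y\<close> does.\<close>
    define W where "W = rotate i Z"
    have W: "is_cycle_list C E W" unfolding W_def by (rule is_cycle_list_rotate[OF Z])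
    then have W': "length W \<ge> 3" "distinct W" by (auto simp: is_cycle_list_def)
    have idx: "W ! k = W ! (l mod length W) \<longleftrightarrow> k = l mod length W" if "k < length W" for k l
    proof (rule nth_eq_iff_index_eq[OF W'(2) that])
      show "l mod length W < length W" using W'(1) by (intro mod_less_divisor) linarith
    qed
    \<comment> \<open>A directed chord is a detour with a single step.\<close>
    have no_chord: "j = Suc i mod length W \<or> i = Suc j mod length W"
      if ij: "i < length W" "j < length W" "W ! i \<noteq> W ! j" and e: "E (W ! i) (W ! j)" for i j
    proof (rule ccontr)
      assume no: "\<not> ?thesis"
      have "conv_radius (nb_count E) < 1"
      proof (rule detour_conv_radius_less_1[OF W, of i "[W ! j]" j])
        show "hd [W ! j] \<noteq> W ! ((i + 1) mod length W)" using no ij idx by simp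
        have "Suc (i + length W - 1) = i + length W" using W'(1) by simp
        then have "Suc ((i + length W - 1) mod length W) mod length W = i"
          using ij(1) mod_Suc_eq[of "i + length W - 1" "length W"] by simp
        then have "j \<noteq> (i + length W - 1) mod length W" using no by auto
        then show "hd [W ! j] \<noteq> W ! ((i + length W - 1) mod length W)"
          using idx ij by simp
        show "last (butlast (W ! (i mod length W) # [W ! j])) \<noteq> W ! ((j + 1) mod length W)"
          using no idx ij by simp
      qed (use ij e in \<open>auto simp: is_nbtw_Cons_Cons\<close>)
      then show False using growth by simp
    qed
    have chordless: "j = Suc i mod length W \<or> i = Suc j mod length W"
      if "i < length W" "j < length W" "?U (W ! i) (W ! j)" for i j
      using that no_chord[of i j] no_chord[of j i] by (auto simp: undir_adj_def)
    have "hd Y = hd W" 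
    proof -
      have "Z \<noteq> []" using i(1) by auto
      then show ?thesis using i hd_rotate_conv_nth[of Z i] by (simp add: W_def)
    qed
    then have "cycle_class Y = cycle_class W"
      by (intro cycle_class_eq_chordless[OF W' Y _ _ undir_adj_sym chordless])
         (use sub in \<open>auto simp: W_def\<close>)
    then show ?thesis by (simp add: W_def)
  qed
  then have "cycles C ?U \<subseteq> {cycle_class Z}" by (auto simp: cycles_def)
  then have "card (cycles C ?U) \<le> card {cycle_class Z}" by (rule card_mono[rotated]) simp
  then show False using two by simp
qed

section \<open>Acyclic and unicyclic components\<close>

text \<open>Winding around a directed cycle gives a walk of every length, so the terms of the series
  at 1 do not tend to 0.\<close>

theorem scc_cycle_conv_radius:
  fixes E :: "'n::finite \<Rightarrow> 'n \<Rightarrow> bool"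
  assumes C: "C \<in> scc_classes E" and "cycles C (undir_adj E C) \<noteq> {}"
  shows "conv_radius (nb_count E) \<le> 1"
proof -
  obtain Z where Z: "is_cycle_list C E Z"
    using scc_directed_cycle[OF C] assms(2) by (auto simp: cycles_def)
  have "1 \<le> nb_count E k" for k
  proof -
    have "map (\<lambda>i. Z ! (i mod length Z)) [0..<Suc k] \<in> {vs. length vs = Suc k \<and> is_nbtw E vs}"
      using cycle_walk_nbtw[OF Z, of 0 "Suc k"] by (simp del: upt_Suc)
    then have "card {vs. length vs = Suc k \<and> is_nbtw E vs} > 0"
      using finite_length_eq[of "Suc k" "is_nbtw E"] by (subst card_gt_0_iff) blast
    then show ?thesis by (simp add: nb_count_def)
  qed
  then have "\<not> nb_count E \<longlonglongrightarrow> 0"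
    using tendsto_lowerbound[of "nb_count E" 0 sequentially 1] by auto
  then have "\<not> summable (\<lambda>n. nb_count E n * 1 ^ n)"
    using summable_LIMSEQ_zero by auto
  then have "conv_radius (nb_count E) \<le> norm (1::real)" by (rule conv_radius_leI')
  then show ?thesis by (simp add: one_ereal_def)
qed

text \<open>All vertices of a directed cycle reach each other.\<close>

lemma directed_cycle_in_scc:
  assumes c: "is_cycle_list D E c" and noloops: "\<And>x. \<not> E x x"
  shows "\<exists>C \<in> scc_classes E. is_cycle_list C (undir_adj E C) c"
proof -
  obtain a w where w: "c = a # w" using c by (cases c) (auto simp: is_cycle_list_def)
  obtain C where C: "C \<in> scc_classes E" "a \<in> C" using scc_classes_ex[of E a] by blast
  have c': "length c \<ge> 3" "distinct c" "successively E c" "E (last c) (hd c)"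
    using c by (auto simp: is_cycle_list_iff)
  have sub: "set c \<subseteq> C"
  proof
    fix x assume x: "x \<in> set c"
    obtain ps ss where *: "c = ps @ x # ss" using split_list[OF x] by blast
    have "successively E (x # ss)" using c'(3) unfolding * by (simp add: successively_append_iff)
    then have "E\<^sup>*\<^sup>* x (last (x # ss))" by (rule successively_rtranclp) (metis last_in_set list.distinct(1))
    also have "last (x # ss) = last c" by (simp add: *)
    also have "E\<^sup>*\<^sup>* \<dots> a" using c'(4) w by auto
    finally show "x \<in> C"
      using scc_classes_closed[OF C _ _ C(2)] successively_rtranclp c'(3) x w by metis
  qed
  have U: "undir_adj E C x y" if "E x y" "x \<in> set c" "y \<in> set c" for x y
    using that sub noloops by (auto simp: undir_adj_def)
  have "successively (undir_adj E C) c"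
    using c'(3) U by (auto simp: successively_conv_nth)
  moreover have "undir_adj E C (last c) (hd c)" using c'(4) U w by simp
  ultimately show ?thesis using C sub c' unfolding is_cycle_list_iff by blast
qed

text \<open>A repeated vertex would yield a directed cycle, which lies inside one component; so
  every walk is a path, with at most \<open>CARD('n)\<close> vertices.\<close>

theorem scc_acyclic_nb_count:
  fixes E :: "'n::finite \<Rightarrow> 'n \<Rightarrow> bool"
  assumes acyclic: "\<And>C. C \<in> scc_classes E \<Longrightarrow> cycles C (undir_adj E C) = {}"
    and noloops: "\<And>x. \<not> E x x" and k: "k \<ge> CARD('n)"
  shows "nb_count E k = 0"
proof -
  have "distinct vs" if vs: "is_nbtw E vs" for vs
  proof (rule ccontr)
    assume "\<not> distinct vs"
    then obtain c where c: "is_cycle_list (set vs) E c"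
      using nbtw_contains_cycle[OF vs _ noloops] by blast
    obtain C where "C \<in> scc_classes E" "is_cycle_list C (undir_adj E C) c"
      using directed_cycle_in_scc[OF c noloops] by blast
    then show False using acyclic by (auto simp: cycles_def)
  qed
  moreover have "length vs \<le> CARD('n)" if "distinct vs" for vs :: "'n list"
    using distinct_card[OF that] card_mono[of UNIV "set vs"] by simp
  ultimately have "{vs. length vs = Suc k \<and> is_nbtw E vs} = {}"
    using k by fastforce
  then show ?thesis unfolding nb_count_def by (simp only: card.empty of_nat_0)
qed

section \<open>The non-backtracking (Hashimoto) edge graph\<close>

definition nb_step :: "('n \<Rightarrow> 'n \<Rightarrow> bool) \<Rightarrow> 'n \<times> 'n \<Rightarrow> 'n \<times> 'n \<Rightarrow> bool" where
  "nb_step E e f \<longleftrightarrow> snd e = fst f \<and> E (fst e) (snd e) \<and> E (fst f) (snd f) \<and> snd f \<noteq> fst e"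

text \<open>The final edge is located in the whole list, since it may overlap or equal the initial
  one.\<close>

lemma nb_step_walk:
  assumes "(nb_step E)\<^sup>*\<^sup>* (u, v) (a, b)" "E u v"
  shows "\<exists>ws xs. is_nbtw E (u # v # ws) \<and> u # v # ws = xs @ [a, b]"
  using assms(1)
proof (induction "(a, b)" arbitrary: a b rule: rtranclp_induct)
  case base
  then show ?case using assms(2) by (intro exI[of _ "[]"]) (auto simp: is_nbtw_Cons_Cons)
next
  case (step y a b)
  obtain c where y: "y = (c, a)" and c: "E c a" "E a b" "b \<noteq> c"
    using step.hyps(2) by (cases y) (auto simp: nb_step_def)
  obtain ws xs where w: "is_nbtw E (u # v # ws)" "u # v # ws = xs @ [c, a]"
    using step.hyps(3)[OF y] by blast
  have nb: "is_nbtw E (xs @ c # a # [b])"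
    using is_nbtw_overlap[of E xs c a "[b]"] w c by (simp add: is_nbtw_Cons_Cons)
  have eq: "u # v # ws @ [b] = xs @ c # a # [b]" using w(2) by simp
  show ?case
  proof (intro exI conjI)
    show "is_nbtw E (u # v # ws @ [b])" unfolding eq by (rule nb)
    show "u # v # ws @ [b] = (xs @ [c]) @ [a, b]" unfolding eq by simp
  qed
qed

text \<open>For following a walk in a graph with the edge \<open>e\<close> removed: \<open>p\<close>
  stops just before the first use of \<open>e\<close>, and is empty if that is the first
  step.\<close>

lemma split_at_edge:
  assumes "successively U (v # xs)" "\<not> successively (\<lambda>x y. U x y \<and> {x, y} \<noteq> e) (v # xs)"
  shows "\<exists>p s. xs = p @ s \<and> s \<noteq> [] \<and> successively (\<lambda>x y. U x y \<and> {x, y} \<noteq> e) (v # p) \<and>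
           {last (v # p), hd s} = e"
  using assms
proof (induction xs arbitrary: v)
  case Nil
  then show ?case by simp
next
  case (Cons y ys)
  show ?case
  proof (cases "{v, y} = e")
    case True
    then show ?thesis by - (rule exI[of _ "[]"], rule exI[of _ "y # ys"], auto)
  next
    case False
    then obtain p s where "ys = p @ s" "s \<noteq> []"
      "successively (\<lambda>x y. U x y \<and> {x, y} \<noteq> e) (y # p)" "{last (y # p), hd s} = e"
      using Cons.IH[of y] Cons.prems by auto
    then show ?thesis using False Cons.prems by - (rule exI[of _ "y # p"], rule exI[of _ s], auto)
  qed
qed

text \<open>Remove an edge of a cycle. If no other cycle existed, the rest would be a forest. But following the
  two loops from v until they first use the removed edge, and the first loop also backwards,
  gives three distinct directions from v in the forest leading to the two ends of that edge,
  so two of them close up to a cycle.\<close>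

lemma two_returning_steps_two_cycles:
  fixes E :: "'n::finite \<Rightarrow> 'n \<Rightarrow> bool"
  assumes noloops: "\<And>x. \<not> E x x"
    and step: "nb_step E (u, v) (v, w1)" "nb_step E (u, v) (v, w2)" "w1 \<noteq> w2"
    and ret: "(nb_step E)\<^sup>*\<^sup>* (v, w1) (u, v)" "(nb_step E)\<^sup>*\<^sup>* (v, w2) (u, v)"
  shows "\<exists>C \<in> scc_classes E. card (cycles C (undir_adj E C)) > 1"
proof -
  obtain C where C: "C \<in> scc_classes E" "v \<in> C" using scc_classes_ex[of E v] by blast
  define U where "U = undir_adj E C"
  have sym: "U x y \<Longrightarrow> U y x" and irrefl: "\<not> U x x" for x y
    by (auto simp: U_def undir_adj_sym undir_adj_irrefl)
  have UC: "x \<in> C" if "U x y" for x y using that by (simp add: U_def undir_adj_def)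
  \<comment> \<open>Each vertex of the loop reaches \<open>v\<close> and is reached from it, so the
    loop stays in \<open>C\<close>.\<close>
  have loop: "\<exists>ws. is_nbtw U (v # w # ws) \<and> (\<exists>xs. v # w # ws = xs @ [u, v])"
    if "E v w" and wret: "(nb_step E)\<^sup>*\<^sup>* (v, w) (u, v)" for w
  proof -
    obtain ws xs where w: "is_nbtw E (v # w # ws)" "v # w # ws = xs @ [u, v]"
      using nb_step_walk[OF wret \<open>E v w\<close>] by blast
    have s: "successively E (v # w # ws)" using w(1) by (rule is_nbtw_imp_successively)
    have inC: "x \<in> C" if x: "x \<in> set (v # w # ws)" for x
    proof -
      obtain ps ss where *: "v # w # ws = ps @ x # ss" using split_list[OF x] by blast
      have "successively E (x # ss)" using s unfolding * by (simp add: successively_append_iff)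
      then have "E\<^sup>*\<^sup>* x (last (x # ss))" by (rule successively_rtranclp) (metis last_in_set list.distinct(1))
      also have "last (x # ss) = last (v # w # ws)" unfolding * by simp
      also have "\<dots> = v" unfolding w(2) by simp
      finally show ?thesis
        using scc_classes_closed[OF C _ _ C(2)] successively_rtranclp[OF s x] by blast
    qed
    have "successively U (v # w # ws)"
      unfolding successively_conv_nth
    proof (intro allI impI)
      fix i assume i: "Suc i < length (v # w # ws)"
      then have "E ((v # w # ws) ! i) ((v # w # ws) ! Suc i)" by (rule successively_nth[OF s])
      then show "U ((v # w # ws) ! i) ((v # w # ws) ! Suc i)"
        using noloops inC[OF nth_mem[OF i]] inC[OF nth_mem[of i]] i
        unfolding U_def undir_adj_def by auto
    qed
    then have "is_nbtw U (v # w # ws)" using w(1) is_nbtw_edges by metis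
    then show ?thesis using w(2) by blast
  qed
  have E12: "E v w1" "E v w2" "w1 \<noteq> u" "w2 \<noteq> u" using step by (auto simp: nb_step_def)
  obtain l1 x1 where l1: "is_nbtw U (v # w1 # l1)" "v # w1 # l1 = x1 @ [u, v]"
    using loop[OF E12(1) ret(1)] by blast
  obtain l2 x2 where l2: "is_nbtw U (v # w2 # l2)" "v # w2 # l2 = x2 @ [u, v]"
    using loop[OF E12(2) ret(2)] by blast
  have nd: "\<not> distinct (v # xs)" if "v # xs = ys @ [u, v]" for xs ys
    using that by (cases ys) auto
  have subC: "set xs \<subseteq> C" if "successively U (v # xs)" for xs
  proof
    fix x assume "x \<in> set xs"
    then obtain i where i: "i < length xs" "x = xs ! i" by (metis in_set_conv_nth)
    then have "U ((v # xs) ! i) x" using successively_nth[OF that, of i] by simp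
    then show "x \<in> C" using sym UC by blast
  qed
  obtain Z where "is_cycle_list (set (v # w1 # l1)) U Z"
    using nbtw_contains_cycle[OF l1(1) nd[OF l1(2)] irrefl] by blast
  moreover have "set (v # w1 # l1) \<subseteq> C"
    using subC[OF is_nbtw_imp_successively[OF l1(1)]] C by simp
  ultimately have Z: "is_cycle_list C U Z" by (auto simp: is_cycle_list_def)
  have "card (cycles C U) > 1"
  proof (rule ccontr)
    assume "\<not> ?thesis"
    then have le: "card (cycles C U) \<le> Suc 0" by simp
    define a b where "a = Z ! 0" and "b = Z ! 1"
    define F where "F = (\<lambda>x y. U x y \<and> {x, y} \<noteq> {a, b})"
    \<comment> \<open>Such a cycle would be \<open>Z\<close> up to rotation and reversal, yet
      \<open>Z\<close> uses the removed edge.\<close>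
    have forest: False if c: "is_cycle_list C F c" for c
    proof -
      have "is_cycle_list C U c" using is_cycle_list_mono[OF c order_refl] by (auto simp: F_def)
      then have "cycle_class c = cycle_class Z"
        using Z card_le_Suc0_iff_eq[OF finite_cycles, of C U] le by (auto simp: cycles_def)
      then have "Z \<in> cycle_class c" using cycle_class_refl by metis
      then have "is_cycle_list C F Z"
        using is_cycle_list_class[OF c] sym by (simp add: F_def insert_commute)
      then have "F a b" by (simp add: is_cycle_list_def a_def b_def)
      then show False by (simp add: F_def)
    qed
    have dist: "distinct xs" if xs: "is_nbtw F xs" "set xs \<subseteq> C" for xs
    proof (rule ccontr)
      assume "\<not> distinct xs"
      moreover have "\<not> F x x" for x using irrefl by (simp add: F_def)
      ultimately obtain c where "is_cycle_list (set xs) F c"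
        using nbtw_contains_cycle[OF xs(1)] by blast
      then have "is_cycle_list C F c" using xs(2) by (auto simp: is_cycle_list_def)
      then show False by (rule forest)
    qed
    \<comment> \<open>A way from \<open>v\<close> in direction \<open>d\<close> to an end of the
      removed edge. The empty list stands for the case that the first step is that edge
      itself.\<close>
    define branch where "branch d p \<longleftrightarrow> is_nbtw F (v # p) \<and> set p \<subseteq> C \<and> last (v # p) \<in> {a, b} \<and>
       (if p = [] then {v, d} = {a, b} else hd p = d)" for d p
    have branch_ex: "\<exists>p. branch d p" if walk: "is_nbtw U (v # d # r)" "\<not> distinct (v # d # r)" for d r
    proof -
      have s: "successively U (v # d # r)" using walk(1) by (rule is_nbtw_imp_successively)
      have inC: "set (v # d # r) \<subseteq> C" using subC[OF s] C by simp
      have "\<not> successively F (v # d # r)"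
      proof
        assume "successively F (v # d # r)"
        then have "is_nbtw F (v # d # r)" using walk(1) is_nbtw_edges by metis
        then show False using dist inC walk(2) by blast
      qed
      then obtain p q where p: "d # r = p @ q" "q \<noteq> []" "successively F (v # p)"
        "{last (v # p), hd q} = {a, b}"
        using split_at_edge[OF s, of "{a, b}"] unfolding F_def by blast
      have "is_nbtw U ((v # p) @ q)" using walk(1) p(1) by simp
      then have "is_nbtw U (v # p)" by (rule is_nbtw_appendD1) simp
      then have "is_nbtw F (v # p)" using p(3) is_nbtw_edges by metis
      moreover have "set p \<subseteq> C" using inC p(1) by (metis Un_iff list.set_intros(2) set_append subset_iff)
      moreover have "last (v # p) \<in> {a, b}" using p(4) by blast
      moreover have "if p = [] then {v, d} = {a, b} else hd p = d"
      proof (cases p)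
        case Nil
        then show ?thesis using p(1,4) by (metis append_Nil last.simps list.sel(1))
      next
        case (Cons x xs)
        then show ?thesis using p(1) by simp
      qed
      ultimately show ?thesis unfolding branch_def by blast
    qed
    \<comment> \<open>Branches with a common end would glue at \<open>v\<close> to a walk in the
      forest that repeats a vertex; if both are empty, their directions agree.\<close>
    have sep: "last (v # p) \<noteq> last (v # q)" if "branch c p" "branch d q" "c \<noteq> d" for c d p q
    proof
      assume eq: "last (v # p) = last (v # q)"
      have p: "is_nbtw F (v # p)" "set p \<subseteq> C" and q: "is_nbtw F (v # q)" "set q \<subseteq> C"
        using that by (auto simp: branch_def)
      have "is_nbtw F (rev p @ [v])"
        using p(1) is_nbtw_rev[of F "v # p"] sym is_nbtw_mono[of F "v # p" "\<lambda>x y. F y x"]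
        by (auto simp: F_def insert_commute)
      moreover have "p \<noteq> [] \<longrightarrow> q \<noteq> [] \<longrightarrow> last (rev p) \<noteq> hd q"
        using that by (auto simp: branch_def last_rev)
      ultimately have "is_nbtw F (rev p @ v # q)" using q(1) is_nbtw_append_iff[of F "rev p" v q] by simp
      then have d: "distinct (rev p @ v # q)" by (rule dist) (use p q C in auto)
      have "p \<noteq> [] \<or> q \<noteq> []" using that by (auto simp: branch_def doubleton_eq_iff)
      then show False
        using d eq by (cases "p = []"; cases "q = []") (auto simp: disjoint_iff dest: last_in_set)
    qed
    obtain p1 where p1: "branch w1 p1" using branch_ex[OF l1(1) nd[OF l1(2)]] by blast
    obtain p2 where p2: "branch w2 p2" using branch_ex[OF l2(1) nd[OF l2(2)]] by blast
    \<comment> \<open>Traversed backwards, the first loop leaves \<open>v\<close> towards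
      \<open>u\<close>, the third direction.\<close>
    have "rev (v # w1 # l1) = v # u # rev x1" unfolding l1(2) by simp
    moreover have "is_nbtw U (rev (v # w1 # l1))"
      unfolding is_nbtw_rev using l1(1) sym by (rule is_nbtw_mono)
    moreover have "\<not> distinct (rev (v # w1 # l1))" using nd[OF l1(2)] unfolding distinct_rev .
    ultimately obtain p3 where p3: "branch u p3" using branch_ex by metis
    have "last (v # p) \<in> {a, b}" if "branch d p" for d p using that by (simp add: branch_def)
    then show False
      using sep[OF p1 p2 step(3)] sep[OF p1 p3 E12(3)] sep[OF p2 p3 E12(4)] p1 p2 p3 
      by (metis insertE singletonD)
  qed
  then show ?thesis using C by (auto simp: U_def)
qed

text \<open>\<open>R\<close> counts the pairs reachable in the edge graph, the start included. At
  most one successor can return, and along it \<open>R\<close> does not increase. Along the other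
  successors, at most \<open>CARD('n)\<close> many, \<open>R\<close> drops, which gains a factor
  \<open>1 / B\<close>; by the choice of \<open>B\<close> they add up to at most \<open>eps\<close>
  times the bound. Hence the factor \<open>1 + eps\<close> per step.\<close>

lemma card_nb_ext_bound:
  fixes E :: "'n::finite \<Rightarrow> 'n \<Rightarrow> bool" and eps :: real
  assumes uniq: "\<And>u v w1 w2. nb_step E (u, v) (v, w1) \<Longrightarrow> nb_step E (u, v) (v, w2) \<Longrightarrow>
      (nb_step E)\<^sup>*\<^sup>* (v, w1) (u, v) \<Longrightarrow> (nb_step E)\<^sup>*\<^sup>* (v, w2) (u, v) \<Longrightarrow> w1 = w2"
    and eps: "0 < eps" "eps \<le> 1"
  defines "B \<equiv> real CARD('n) / eps" and "R \<equiv> \<lambda>e. card {f. (nb_step E)\<^sup>*\<^sup>* e f}"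
  shows "real (card (nb_ext E u v k)) \<le> B ^ R (u, v) * (1 + eps) ^ k"
proof (induction k arbitrary: u v)
  have "real CARD('n) \<ge> 1" by (simp add: Suc_le_eq)
  then have "eps \<le> real CARD('n)" using eps(2) by linarith
  then have B: "B \<ge> 1" using eps by (simp add: B_def)
  {
    case 0
    have "card (nb_ext E u v 0) \<le> card {[] :: 'n list}"
      by (rule card_mono) (auto simp: nb_ext_def)
    then show ?case using B by (simp add: order_trans[OF _ one_le_power])
  next
    case (Suc k)
    define S where "S = {w. nb_step E (u, v) (v, w)}"
    define Q where "Q = {w \<in> S. (nb_step E)\<^sup>*\<^sup>* (v, w) (u, v)}"
    define X where "X = B ^ R (u, v) * (1 + eps) ^ k"
    have X: "X \<ge> 0" using B eps by (simp add: X_def)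
    have sub: "{f. (nb_step E)\<^sup>*\<^sup>* (v, w) f} \<subseteq> {f. (nb_step E)\<^sup>*\<^sup>* (u, v) f}" if "w \<in> S" for w
      using that by (auto simp: S_def intro: converse_rtranclp_into_rtranclp)
    have "nb_ext E u v (Suc k) \<subseteq> (\<Union>w\<in>S. (#) w ` nb_ext E v w k)"
    proof
      fix vs assume vs: "vs \<in> nb_ext E u v (Suc k)"
      then obtain w ws where w: "vs = w # ws" by (auto simp: nb_ext_def length_Suc_conv)
      have nb: "is_nbtw E (u # v # w # ws)" using vs w by (simp add: nb_ext_def)
      then have "w \<in> S" "ws \<in> nb_ext E v w k"
        using vs w by (auto simp: S_def nb_step_def nb_ext_def is_nbtw_Cons_Cons)
      then show "vs \<in> (\<Union>w\<in>S. (#) w ` nb_ext E v w k)" using w by blast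
    qed
    then have "card (nb_ext E u v (Suc k)) \<le> card (\<Union>w\<in>S. (#) w ` nb_ext E v w k)"
      by (intro card_mono) auto
    also have "\<dots> \<le> (\<Sum>w\<in>S. card ((#) w ` nb_ext E v w k))"
      by (intro card_UN_le) simp
    also have "\<dots> = (\<Sum>w\<in>S. card (nb_ext E v w k))"
      by (simp add: card_image)
    finally have "real (card (nb_ext E u v (Suc k))) \<le> (\<Sum>w\<in>S. real (card (nb_ext E v w k)))"
      by (simp flip: of_nat_sum)
    also have "\<dots> = (\<Sum>w\<in>Q. real (card (nb_ext E v w k))) + (\<Sum>w\<in>S - Q. real (card (nb_ext E v w k)))"
      using sum.subset_diff[of Q S "\<lambda>w. real (card (nb_ext E v w k))"]
      by (simp add: Q_def add.commute)
    also have "(\<Sum>w\<in>Q. real (card (nb_ext E v w k))) \<le> X"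
    proof -
      have "card Q \<le> Suc 0"
        using uniq unfolding card_le_Suc0_iff_eq[OF finite] by (auto simp: Q_def S_def)
      have "real (card (nb_ext E v w k)) \<le> X" if "w \<in> Q" for w
      proof -
        have "R (v, w) \<le> R (u, v)"
          unfolding R_def using sub that by (intro card_mono) (auto simp: Q_def)
        then have "B ^ R (v, w) \<le> B ^ R (u, v)" using B by (rule power_increasing)
        then show ?thesis unfolding X_def using Suc.IH[of v w] eps
          by (elim order_trans) (intro mult_right_mono, auto)
      qed
      then have "(\<Sum>w\<in>Q. real (card (nb_ext E v w k))) \<le> real (card Q) * X"
        by (rule sum_bounded_above)
      also have "\<dots> \<le> 1 * X" using \<open>card Q \<le> Suc 0\<close> X by (intro mult_right_mono) auto
      finally show ?thesis by simp
    qed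
    also have "(\<Sum>w\<in>S - Q. real (card (nb_ext E v w k))) \<le> eps * X"
    proof -
      have "real (card (nb_ext E v w k)) \<le> X / B" if "w \<in> S - Q" for w
      proof -
        \<comment> \<open>By reflexivity \<open>(u, v)\<close> is counted in
          \<open>R (u, v)\<close>, so the inclusion of reachable sets is strict.\<close>
        have "(u, v) \<notin> {f. (nb_step E)\<^sup>*\<^sup>* (v, w) f}" using that by (auto simp: Q_def)
        then have "R (v, w) < R (u, v)"
          unfolding R_def using sub[of w] that by (intro psubset_card_mono) auto
        then have "R (v, w) \<le> R (u, v) - 1" "R (u, v) = Suc (R (u, v) - 1)" by auto
        then have "B ^ R (v, w) \<le> B ^ R (u, v) / B"
          using B power_increasing[of "R (v, w)" "R (u, v) - 1" B]
          by (metis less_le_trans nonzero_mult_div_cancel_left not_one_le_zero power_Suc)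
        then show ?thesis unfolding X_def times_divide_eq_left[symmetric] using Suc.IH[of v w] eps
          by (elim order_trans) (intro mult_right_mono, auto)
      qed
      then have "(\<Sum>w\<in>S - Q. real (card (nb_ext E v w k))) \<le> real (card (S - Q)) * (X / B)"
        by (rule sum_bounded_above)
      also have "\<dots> \<le> real CARD('n) * (X / B)"
        using X B by (intro mult_right_mono) (auto intro: card_mono)
      also have "\<dots> = eps * X" using B eps by (simp add: B_def)
      finally show ?thesis .
    qed
    finally show ?case by (simp add: X_def algebra_simps)
  }
qed

theorem sccs_le_one_cycle_conv_radius:
  fixes E :: "'n::finite \<Rightarrow> 'n \<Rightarrow> bool"
  assumes noloops: "\<And>x. \<not> E x x"
    and one: "\<And>C. C \<in> scc_classes E \<Longrightarrow> card (cycles C (undir_adj E C)) \<le> 1"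
  shows "1 \<le> conv_radius (nb_count E)"
proof (rule conv_radius_geI_ex')
  fix r :: real assume r: "0 < r" "ereal r < 1"
  then have "r < 1" by simp
  \<comment> \<open>Makes \<open>(1 + eps) * r\<close> at most \<open>(1 + r) / 2\<close>; the
    minimum with 1 is for the growth bound, which assumes \<open>eps \<le> 1\<close>.\<close>
  define eps where "eps = min 1 ((1 / r - 1) / 2)"
  have eps: "0 < eps" "eps \<le> 1" using r(1) \<open>r < 1\<close> by (auto simp: eps_def)
  have "(1 + eps) * r \<le> (1 + (1 / r - 1) / 2) * r"
    using r(1) unfolding eps_def by (intro mult_right_mono add_left_mono min.cobounded2) auto
  also have "\<dots> = (1 + r) / 2" using r(1) by (simp add: field_simps)
  also have "\<dots> < 1" using \<open>r < 1\<close> by simp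
  finally have lt: "(1 + eps) * r < 1" .
  \<comment> \<open>Two returning successors would put two cycles into one component.\<close>
  have uniq: "w1 = w2"
    if "nb_step E (u, v) (v, w1)" "nb_step E (u, v) (v, w2)"
      "(nb_step E)\<^sup>*\<^sup>* (v, w1) (u, v)" "(nb_step E)\<^sup>*\<^sup>* (v, w2) (u, v)" for u v w1 w2
    using two_returning_steps_two_cycles[OF noloops that(1,2) _ that(3,4)] one
    by (metis not_less)
  define B where "B = real CARD('n) / eps"
  define c where "c = real (CARD('n \<times> 'n)) * B ^ CARD('n \<times> 'n)"
  have "real CARD('n) \<ge> 1" by (simp add: Suc_le_eq)
  then have "eps \<le> real CARD('n)" using eps(2) by linarith
  then have B: "B \<ge> 1" using eps by (simp add: B_def)
  have bound: "nb_count E (Suc k) \<le> c * (1 + eps) ^ k" for k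
  proof -
    let ?A = "\<lambda>e. (\<lambda>vs. fst e # snd e # vs) ` nb_ext E (fst e) (snd e) k"
    have "{vs. length vs = Suc (Suc k) \<and> is_nbtw E vs} \<subseteq> (\<Union>e\<in>UNIV. ?A e)"
    proof
      fix vs assume "vs \<in> {vs. length vs = Suc (Suc k) \<and> is_nbtw E vs}"
      then obtain a b ws where "vs = a # b # ws" "ws \<in> nb_ext E a b k"
        by (auto simp: length_Suc_conv nb_ext_def)
      then show "vs \<in> (\<Union>e\<in>UNIV. ?A e)" by force
    qed
    then have "card {vs. length vs = Suc (Suc k) \<and> is_nbtw E vs} \<le> card (\<Union>e\<in>UNIV. ?A e)"
      by (intro card_mono) auto
    also have "\<dots> \<le> (\<Sum>e\<in>UNIV. card (?A e))" by (intro card_UN_le) simp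
    also have "\<dots> = (\<Sum>e\<in>UNIV. card (nb_ext E (fst e) (snd e) k))"
      by (intro sum.cong refl card_image) (auto simp: inj_on_def)
    finally have "nb_count E (Suc k) \<le> (\<Sum>e\<in>UNIV. real (card (nb_ext E (fst e) (snd e) k)))"
      unfolding nb_count_def by (simp flip: of_nat_sum)
    also have "\<dots> \<le> real (CARD('n \<times> 'n)) * (B ^ CARD('n \<times> 'n) * (1 + eps) ^ k)"
    proof (rule sum_bounded_above)
      fix e :: "'n \<times> 'n"
      let ?R = "card {f. (nb_step E)\<^sup>*\<^sup>* e f}"
      have "real (card (nb_ext E (fst e) (snd e) k)) \<le> B ^ ?R * (1 + eps) ^ k"
        using card_nb_ext_bound[OF uniq eps, where u = "fst e" and v = "snd e" and k = k] by (simp add: B_def)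
      also have "\<dots> \<le> B ^ CARD('n \<times> 'n) * (1 + eps) ^ k"
        using B eps by (intro mult_right_mono power_increasing card_mono) auto
      finally show "real (card (nb_ext E (fst e) (snd e) k)) \<le> B ^ CARD('n \<times> 'n) * (1 + eps) ^ k" .
    qed
    finally show ?thesis by (simp add: c_def mult.assoc)
  qed
  have "summable (\<lambda>n. (c * r) * ((1 + eps) * r) ^ n)"
    using lt eps r(1) by (intro summable_mult summable_geometric) auto
  then have "summable (\<lambda>n. nb_count E (Suc n) * r ^ Suc n)"
  proof (rule summable_comparison_test')
    fix n :: nat
    have "nb_count E (Suc n) * r ^ Suc n \<le> (c * (1 + eps) ^ n) * r ^ Suc n"
      using bound r(1) by (intro mult_right_mono) auto
    then show "norm (nb_count E (Suc n) * r ^ Suc n) \<le> (c * r) * ((1 + eps) * r) ^ n"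
      using r(1) nb_count_nonneg[of E "Suc n"] by (simp add: power_mult_distrib mult_ac abs_mult)
  qed
  then show "summable (\<lambda>n. nb_count E n * of_real r ^ n)"
    by (subst (asm) summable_Suc_iff) simp
qed

section \<open>The generating function of non-backtracking walks\<close>

lemma finite_nbtws [simp]: "finite (nbtws E k i j :: 'n::finite list set)"
  unfolding nbtws_def by (simp only: Suc_eq_plus1[symmetric]) (rule finite_length_eq)

lemma p_mat_nonneg: "0 \<le> p_mat E k $ i $ j"
  by (simp add: p_mat_def)

lemma nb_count_eq_sum: "nb_count E k = (\<Sum>i\<in>UNIV. \<Sum>j\<in>UNIV. p_mat E k $ i $ j)"
proof -
  have "{vs. length vs = Suc k \<and> is_nbtw E vs} = (\<Union>e\<in>UNIV. nbtws E k (fst e) (snd e))"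
    by (auto simp: nbtws_def)
  then have "card {vs. length vs = Suc k \<and> is_nbtw E vs} = (\<Sum>e\<in>UNIV. card (nbtws E k (fst e) (snd e)))"
    by (simp only:, intro card_UN_disjoint) (simp, simp, auto simp: nbtws_def)
  also have "\<dots> = (\<Sum>i\<in>UNIV. \<Sum>j\<in>UNIV. card (nbtws E k i j))"
    by (simp add: sum.cartesian_product case_prod_beta flip: UNIV_Times_UNIV)
  finally show ?thesis by (simp add: nb_count_def p_mat_def)
qed

lemma p_mat_le_nb_count: "p_mat E k $ i $ j \<le> nb_count E k"
proof -
  have "p_mat E k $ i $ j \<le> (\<Sum>j\<in>UNIV. p_mat E k $ i $ j)"
    by (rule member_le_sum) (auto simp: p_mat_nonneg)
  also have "\<dots> \<le> nb_count E k"
    unfolding nb_count_eq_sum by (rule member_le_sum) (auto simp: p_mat_nonneg intro: sum_nonneg)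
  finally show ?thesis .
qed

text \<open>A walk of length 0 has no second vertex, so \<open>vs ! 1\<close> would be unspecified;
  the guard makes the count 0 there.\<close>

definition p_via :: "('n \<Rightarrow> 'n \<Rightarrow> bool) \<Rightarrow> nat \<Rightarrow> 'n \<Rightarrow> 'n \<Rightarrow> 'n \<Rightarrow> real" where
  "p_via E k i x j = real (card {vs \<in> nbtws E k i j. k \<noteq> 0 \<and> vs ! 1 = x})"

lemma p_via_0 [simp]: "p_via E 0 i x j = 0"
  by (simp add: p_via_def)

lemma p_via_nonneg: "0 \<le> p_via E k i x j"
  by (simp add: p_via_def)

lemma p_via_le: "p_via E k i x j \<le> p_mat E k $ i $ j"
  unfolding p_via_def p_mat_def by (simp add: card_mono)

lemma p_mat_0: "p_mat E 0 $ i $ j = (if i = j then 1 else 0)"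
proof -
  have "nbtws E 0 i j = (if i = j then {[i]} else {})"
    by (auto simp: nbtws_def length_Suc_conv)
  then show ?thesis by (simp add: p_mat_def)
qed

lemma p_mat_Suc: "p_mat E (Suc k) $ i $ j = (\<Sum>x\<in>UNIV. p_via E (Suc k) i x j)"
proof -
  have "nbtws E (Suc k) i j = (\<Union>x\<in>UNIV. {vs \<in> nbtws E (Suc k) i j. vs ! 1 = x})" by auto
  then have "card (nbtws E (Suc k) i j) = card (\<Union>x\<in>UNIV. {vs \<in> nbtws E (Suc k) i j. vs ! 1 = x})"
    by simp
  also have "\<dots> = (\<Sum>x\<in>UNIV. card {vs \<in> nbtws E (Suc k) i j. vs ! 1 = x})"
    by (intro card_UN_disjoint) auto
  finally show ?thesis by (simp add: p_mat_def p_via_def)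
qed

text \<open>Without its first vertex such a walk starts at \<open>x\<close> and does not step back
  to \<open>i\<close> at once. This couples the pairs \<open>i\<close>, \<open>x\<close> and
  \<open>x\<close>, \<open>i\<close>.\<close>

lemma p_via_Suc:
  "p_via E (Suc k) i x j = adj_mat E $ i $ x * (p_mat E k $ x $ j - p_via E k x i j)"
proof -
  let ?V = "{vs \<in> nbtws E k x j. k \<noteq> 0 \<and> vs ! 1 = i}"
  have "{vs \<in> nbtws E (Suc k) i j. Suc k \<noteq> 0 \<and> vs ! 1 = x} =
      (if E i x then (#) i ` (nbtws E k x j - ?V) else {})" (is "?L = ?R")
  proof (intro equalityI subsetI)
    fix vs assume vs: "vs \<in> ?L"
    then obtain ws where ws: "vs = i # x # ws"
      by (auto simp: nbtws_def length_Suc_conv)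
    then have "E i x" "x # ws \<in> nbtws E k x j - ?V"
      using vs by (cases ws; auto simp: nbtws_def is_nbtw_Cons_Cons)+
    then show "vs \<in> ?R" using ws by auto
  next
    fix vs assume "vs \<in> ?R"
    then have "E i x" "vs \<in> (#) i ` (nbtws E k x j - ?V)" by (simp_all split: if_splits)
    then obtain ws where ws: "vs = i # ws" "E i x" "ws \<in> nbtws E k x j - ?V" by blast
    then obtain us where us: "ws = x # us" by (cases ws) (auto simp: nbtws_def)
    have "hd us \<noteq> i" if "us \<noteq> []"
      using ws(3) that unfolding us by (cases us) (auto simp: nbtws_def)
    then show "vs \<in> ?L"
      using ws us by (auto simp: nbtws_def is_nbtw_Cons_Cons)
  qed
  moreover have "card (nbtws E k x j - ?V) = card (nbtws E k x j) - card ?V"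
    by (intro card_Diff_subset) auto
  moreover have "card ?V \<le> card (nbtws E k x j)" by (intro card_mono) auto
  ultimately show ?thesis
    by (simp add: p_via_def p_mat_def adj_mat_def card_image)
qed

text \<open>The diagonal of \<open>D\<close> is written as row sums of \<open>S\<close>, the form in
  which the elimination of first steps produces it.\<close>

lemma deformed_laplacian_nth:
  "deformed_laplacian E t $ i $ j = (if i = j then 1 - t\<^sup>2 + t\<^sup>2 * (\<Sum>x\<in>UNIV. S_mat E $ i $ x) else 0)
     - t * adj_mat E $ i $ j + t ^ 3 * (adj_mat E $ i $ j - S_mat E $ i $ j)"
  by (auto simp: deformed_laplacian_def D_mat_def S_mat_def matrix_matrix_mult_def mat_def algebra_simps)

definition nb_gf :: "('n::finite \<Rightarrow> 'n \<Rightarrow> bool) \<Rightarrow> real \<Rightarrow> real^'n^'n" where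
  "nb_gf E t = (\<chi> i j. \<Sum>k. p_mat E k $ i $ j * t ^ k)"

text \<open>Splitting off the first vertex gives linear equations for the series \<open>f\<close> of
  all walks and \<open>g\<close> of walks with a given first step. Summing the solved form of
  \<open>g\<close> over all first steps turns \<open>f_eq\<close> into an entry of the matrix
  equation.\<close>

lemma nb_gf_equation:
  assumes t: "0 \<le> t" and summ: "summable (\<lambda>k. nb_count E k * t ^ k)"
  shows "deformed_laplacian E t ** nb_gf E t = (1 - t\<^sup>2) *\<^sub>R mat 1"
proof -
  have sp: "summable (\<lambda>k. p_mat E k $ i $ j * t ^ k)" for i j
    using t p_mat_nonneg[of E] p_mat_le_nb_count[of E]
    by (intro summable_comparison_test'[OF summ]) (auto simp: abs_mult intro: mult_right_mono)
  have sv: "summable (\<lambda>k. p_via E k i x j * t ^ k)" for i x j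
    using t p_via_nonneg[of E] p_via_le[of E]
    by (intro summable_comparison_test'[OF sp[of i j]]) (auto simp: abs_mult intro: mult_right_mono)
  define f where "f i j = (\<Sum>k. p_mat E k $ i $ j * t ^ k)" for i j
  define g where "g i x j = (\<Sum>k. p_via E k i x j * t ^ k)" for i x j
  have g_eq: "g i x j = t * adj_mat E $ i $ x * (f x j - g x i j)" for i x j
  proof -
    have "g i x j = (\<Sum>k. p_via E (Suc k) i x j * t ^ Suc k)"
      unfolding g_def using suminf_split_head[OF sv[of i x j]] by simp
    also have "\<dots> = (\<Sum>k. t * adj_mat E $ i $ x * (p_mat E k $ x $ j * t ^ k - p_via E k x i j * t ^ k))"
      by (simp add: p_via_Suc algebra_simps)
    also have "\<dots> = t * adj_mat E $ i $ x * (f x j - g x i j)"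
      unfolding f_def g_def using sp sv
      by (subst suminf_mult) (auto intro: summable_diff simp: suminf_diff)
    finally show ?thesis .
  qed
  have f_eq: "f i j = (if i = j then 1 else 0) + (\<Sum>x\<in>UNIV. g i x j)" for i j
  proof -
    have "f i j = (if i = j then 1 else 0) + (\<Sum>k. p_mat E (Suc k) $ i $ j * t ^ Suc k)"
      unfolding f_def using suminf_split_head[OF sp[of i j]] by (simp add: p_mat_0)
    also have "(\<Sum>k. p_mat E (Suc k) $ i $ j * t ^ Suc k) =
        (\<Sum>k. \<Sum>x\<in>UNIV. p_via E (Suc k) i x j * t ^ Suc k)"
      by (simp add: p_mat_Suc sum_distrib_right)
    also have "\<dots> = (\<Sum>x\<in>UNIV. \<Sum>k. p_via E (Suc k) i x j * t ^ Suc k)"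
      using sv by (intro suminf_sum) (subst summable_Suc_iff, simp)
    also have "\<dots> = (\<Sum>x\<in>UNIV. g i x j)"
      unfolding g_def using suminf_split_head[OF sv] by simp
    finally show ?thesis .
  qed
  text \<open>Eliminating \<open>g x i j\<close> from the two equations for the reciprocal pair.\<close>
  have g_solved: "(1 - t\<^sup>2) * g i x j = t * adj_mat E $ i $ x * f x j
      - t ^ 3 * (adj_mat E $ i $ x - S_mat E $ i $ x) * f x j - t\<^sup>2 * S_mat E $ i $ x * f i j" for i x j
    using g_eq[of i x j] g_eq[of x i j]
    by (auto simp: S_mat_def adj_mat_def algebra_simps power2_eq_square power3_eq_cube split: if_splits)
  have "(deformed_laplacian E t ** nb_gf E t) $ i $ j = ((1 - t\<^sup>2) *\<^sub>R mat 1) $ i $ j" for i j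
  proof -
    have "(deformed_laplacian E t ** nb_gf E t) $ i $ j = (\<Sum>x\<in>UNIV. deformed_laplacian E t $ i $ x * f x j)"
      by (simp add: matrix_matrix_mult_def nb_gf_def f_def)
    also have "\<dots> = (\<Sum>x\<in>UNIV. (if i = x then (1 - t\<^sup>2 + t\<^sup>2 * (\<Sum>x\<in>UNIV. S_mat E $ i $ x)) * f x j else 0)
        - (t * adj_mat E $ i $ x * f x j - t ^ 3 * (adj_mat E $ i $ x - S_mat E $ i $ x) * f x j))"
      by (intro sum.cong refl) (auto simp: deformed_laplacian_nth algebra_simps)
    also have "\<dots> = (1 - t\<^sup>2 + t\<^sup>2 * (\<Sum>x\<in>UNIV. S_mat E $ i $ x)) * f i j
        - (\<Sum>x\<in>UNIV. t * adj_mat E $ i $ x * f x j - t ^ 3 * (adj_mat E $ i $ x - S_mat E $ i $ x) * f x j)"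
      by (subst sum_subtractf) simp
    also have "(\<Sum>x\<in>UNIV. t * adj_mat E $ i $ x * f x j - t ^ 3 * (adj_mat E $ i $ x - S_mat E $ i $ x) * f x j)
        = (\<Sum>x\<in>UNIV. (1 - t\<^sup>2) * g i x j + t\<^sup>2 * S_mat E $ i $ x * f i j)"
      by (intro sum.cong refl) (simp add: g_solved)
    also have "\<dots> = (1 - t\<^sup>2) * (\<Sum>x\<in>UNIV. g i x j) + t\<^sup>2 * (\<Sum>x\<in>UNIV. S_mat E $ i $ x) * f i j"
      by (simp add: sum.distrib sum_distrib_left sum_distrib_right)
    also have "(1 - t\<^sup>2 + t\<^sup>2 * (\<Sum>x\<in>UNIV. S_mat E $ i $ x)) * f i j - \<dots> =
        (1 - t\<^sup>2) * (f i j - (\<Sum>x\<in>UNIV. g i x j))"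
      by (simp add: algebra_simps)
    also have "f i j - (\<Sum>x\<in>UNIV. g i x j) = (if i = j then 1 else 0)"
      using f_eq by simp
    finally show ?thesis by (simp add: mat_def)
  qed
  then show ?thesis by (simp add: vec_eq_iff)
qed

text \<open>Below 1 the factor \<open>1 - t\<^sup>2\<close> is nonzero, and dividing by it turns the
  generating function into a right inverse.\<close>

lemma det_deformed_laplacian_nonzero:
  assumes t: "0 < t" "t < 1" and r: "ereal t < conv_radius (nb_count E)"
  shows "det (deformed_laplacian E t) \<noteq> 0"
proof -
  have "summable (\<lambda>k. nb_count E k * t ^ k)"
    using t r by (intro summable_in_conv_radius) simp
  then have eq: "deformed_laplacian E t ** nb_gf E t = (1 - t\<^sup>2) *\<^sub>R mat 1"
    using t by (intro nb_gf_equation) auto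
  have "t\<^sup>2 < 1" using t by (simp add: power_less_one_iff)
  have "deformed_laplacian E t ** ((1 / (1 - t\<^sup>2)) *\<^sub>R nb_gf E t) = mat 1"
    using eq \<open>t\<^sup>2 < 1\<close> by (simp add: matrix_scalar_ac scalar_matrix_assoc flip: scalar_matrix_assoc)
  then show ?thesis
    using invertible_right_inverse invertible_det_nz by metis
qed

text \<open>At 1 the matrix is \<open>D_mat E - S_mat E\<close>, whose rows sum to 0, so the
  all-ones vector lies in the kernel.\<close>

lemma det_deformed_laplacian_1: "det (deformed_laplacian E 1) = 0"
proof -
  have "(deformed_laplacian E 1 *v 1) $ i = 0" for i
  proof -
    have "(deformed_laplacian E 1 *v 1) $ i = (\<Sum>j\<in>UNIV. (if i = j then (\<Sum>x\<in>UNIV. S_mat E $ i $ x) else 0) - S_mat E $ i $ j)"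
      by (auto simp: matrix_vector_mult_def deformed_laplacian_nth intro!: sum.cong)
    also have "\<dots> = 0" by (simp add: sum_subtractf)
    finally show ?thesis .
  qed
  then have "deformed_laplacian E 1 *v 1 = 0" by (simp add: vec_eq_iff)
  moreover have "(1 :: real^'a) \<noteq> 0" by (simp add: vec_eq_iff)
  ultimately show ?thesis
    using matrix_left_invertible_ker invertible_left_inverse invertible_det_nz by metis
qed

section \<open>Singularity at the radius of convergence\<close>

text \<open>Cutting a walk at position \<open>m\<close>, with that vertex kept in both pieces, is
  injective.\<close>

lemma nb_count_submult: "nb_count E (m + k) \<le> nb_count E m * nb_count (E :: 'n::finite \<Rightarrow> _) k"
proof -
  let ?T = "\<lambda>k. {vs. length vs = Suc k \<and> is_nbtw E vs}"
  let ?f = "\<lambda>vs :: 'n list. (take (Suc m) vs, drop m vs)"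
  have "inj_on ?f (?T (m + k))"
  proof (rule inj_onI)
    fix xs ys :: "'n list"
    assume "?f xs = ?f ys"
    then have "take (Suc m) xs = take (Suc m) ys" "drop m xs = drop m ys" by auto
    then have "take m xs = take m ys" "drop m xs = drop m ys"
      by (metis min.absorb1 le_SucI order_refl take_take, simp)
    then show "xs = ys" by (metis append_take_drop_id)
  qed
  moreover have "?f ` ?T (m + k) \<subseteq> ?T m \<times> ?T k"
  proof (intro subsetI, elim imageE)
    fix p and vs :: "'n list" assume p: "p = ?f vs" and vs: "vs \<in> ?T (m + k)"
    then have len: "length vs = Suc (m + k)" and nb: "is_nbtw E vs" by auto
    have "take (Suc m) vs \<noteq> []" "drop m vs \<noteq> []" using len by auto
    then have "is_nbtw E (take (Suc m) vs)" "is_nbtw E (drop m vs)"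
      using is_nbtw_appendD1[of E "take (Suc m) vs" "drop (Suc m) vs"]
        is_nbtw_appendD2[of E "take m vs" "drop m vs"] nb
      unfolding append_take_drop_id by blast+
    then show "p \<in> ?T m \<times> ?T k" using p len by auto
  qed
  ultimately have "card (?T (m + k)) \<le> card (?T m \<times> ?T k)"
    by (intro card_inj_on_le[of ?f]) (auto intro: finite_cartesian_product finite_length_eq)
  then have "card (?T (m + k)) \<le> card (?T m) * card (?T k)" by (simp only: card_cartesian_product)
  then show ?thesis unfolding nb_count_def of_nat_mult[symmetric] of_nat_le_iff .
qed

text \<open>Prolonging by \<open>m\<close> steps does not increase the weighted count, so all terms
  at \<open>s\<close> are bounded by the sum of the first \<open>m\<close>, and a geometric series
  dominates below \<open>s\<close>.\<close>

lemma conv_radius_ge_if_nb_count_small: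
  fixes E :: "'n::finite \<Rightarrow> 'n \<Rightarrow> bool"
  assumes s: "0 < s" and m: "m > 0" and small: "nb_count E m * s ^ m \<le> 1"
  shows "ereal s \<le> conv_radius (nb_count E)"
proof (rule conv_radius_geI_ex')
  define a where "a k = nb_count E k * s ^ k" for k
  have a0: "a k \<ge> 0" for k using s by (simp add: a_def nb_count_nonneg)
  have sub: "a (m + k) \<le> a k" for k
  proof -
    have "a (m + k) \<le> (nb_count E m * nb_count E k) * s ^ (m + k)"
      unfolding a_def using s by (intro mult_right_mono nb_count_submult) auto
    also have "\<dots> = (nb_count E m * s ^ m) * a k" by (simp add: a_def power_add)
    also have "\<dots> \<le> 1 * a k" using small a0 by (intro mult_right_mono)
    finally show ?thesis by simp
  qed
  have mult: "a (q * m + j) \<le> a j" for q j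
  proof (induction q)
    case (Suc q)
    then show ?case using sub[of "q * m + j"] by (simp add: add.assoc)
  qed simp
  define K where "K = (\<Sum>j<m. a j)"
  have K: "a k \<le> K" for k
  proof -
    have "a k = a (k div m * m + k mod m)" by simp
    also have "\<dots> \<le> a (k mod m)" by (rule mult)
    also have "\<dots> \<le> K" unfolding K_def using m a0 by (intro member_le_sum) auto
    finally show ?thesis .
  qed
  fix x :: real assume x: "0 < x" "ereal x < ereal s"
  have "summable (\<lambda>n. K * (x / s) ^ n)" using x s by (intro summable_mult summable_geometric) simp
  then show "summable (\<lambda>n. nb_count E n * of_real x ^ n)"
  proof (rule summable_comparison_test')
    fix n :: nat
    have "nb_count E n * x ^ n = a n * (x / s) ^ n" using s by (simp add: a_def power_divide)
    also have "\<dots> \<le> K * (x / s) ^ n" using x s K by (intro mult_right_mono) auto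
    finally show "norm (nb_count E n * of_real x ^ n) \<le> K * (x / s) ^ n"
      using x nb_count_nonneg[of E n] by (simp add: abs_mult)
  qed
qed

lemma conv_radius_nb_count_pos: "0 < conv_radius (nb_count (E :: 'n::finite \<Rightarrow> _))"
proof -
  \<comment> \<open>Adding 1 keeps the denominator positive for a graph without edges.\<close>
  define s where "s = 1 / (nb_count E 1 + 1)"
  have "0 < s" using nb_count_nonneg[of E 1] by (simp add: s_def)
  moreover have "nb_count E 1 * s ^ 1 \<le> 1" using nb_count_nonneg[of E 1] by (simp add: s_def)
  ultimately have "ereal s \<le> conv_radius (nb_count E)"
    by (intro conv_radius_ge_if_nb_count_small[of s 1]) auto
  with \<open>0 < s\<close> show ?thesis by (metis ereal_less(2) less_le_trans)
qed

text \<open>By submultiplicativity, a single term below 1 at r would push the radius beyond r.\<close>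

lemma not_summable_at_conv_radius:
  fixes E :: "'n::finite \<Rightarrow> 'n \<Rightarrow> bool"
  assumes r: "conv_radius (nb_count E) = ereal r"
  shows "\<not> summable (\<lambda>k. nb_count E k * r ^ k)"
proof
  assume "summable (\<lambda>k. nb_count E k * r ^ k)"
  then have "(\<lambda>k. nb_count E k * r ^ k) \<longlonglongrightarrow> 0" by (rule summable_LIMSEQ_zero)
  then have "\<forall>\<^sub>F k in sequentially. nb_count E k * r ^ k < 1"
    by (rule order_tendstoD) simp
  then have "\<forall>\<^sub>F k in sequentially. nb_count E k * r ^ k < 1 \<and> k > 0"
    using eventually_gt_at_top[of 0] by eventually_elim simp
  then obtain m where m: "nb_count E m * r ^ m < 1" "m > 0"
    using eventually_happens'[OF sequentially_bot] by blast
  \<comment> \<open>By continuity the strict inequality survives slightly to the right of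
    \<open>r\<close>.\<close>
  have "((\<lambda>s. nb_count E m * s ^ m) \<longlongrightarrow> nb_count E m * r ^ m) (at_right r)"
    by (intro tendsto_intros)
  then have "\<forall>\<^sub>F s in at_right r. nb_count E m * s ^ m < 1"
    using m(1) by (rule order_tendstoD)
  then have "\<forall>\<^sub>F s in at_right r. nb_count E m * s ^ m < 1 \<and> s > r"
    using eventually_at_right_less[of r] by eventually_elim simp
  then obtain s where s: "nb_count E m * s ^ m < 1" "s > r"
    using eventually_happens'[OF trivial_limit_at_right_real] by blast
  have "0 < r" using conv_radius_nb_count_pos[of E] r by simp
  then have "ereal s \<le> conv_radius (nb_count E)"
    using conv_radius_ge_if_nb_count_small[of s m E] s m by simp
  then show False using r s(2) by simp
qed

text \<open>If the matrix were invertible at r, the generating function would stay bounded to the left of r,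
  and by monotone convergence it would converge at r.\<close>

lemma det_deformed_laplacian_conv_radius:
  fixes E :: "'n::finite \<Rightarrow> 'n \<Rightarrow> bool"
  assumes r: "conv_radius (nb_count E) = ereal r"
  shows "det (deformed_laplacian E r) = 0"
proof (rule ccontr)
  assume "det (deformed_laplacian E r) \<noteq> 0"
  then obtain N where N: "N ** deformed_laplacian E r = mat 1"
    using invertible_det_nz invertible_left_inverse by blast
  have "0 < r" using conv_radius_nb_count_pos[of E] r by simp
  \<comment> \<open>Tends to the identity as \<open>t\<close> approaches \<open>r\<close>.\<close>
  define G where "G t = N ** deformed_laplacian E t" for t
  let ?n = "real CARD('n)"
  have n: "?n > 0" by simp
  have G_lim: "((\<lambda>t. G t $ i $ k) \<longlongrightarrow> mat 1 $ i $ k) (at_left r)" for i k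
  proof -
    have "((\<lambda>t. G t $ i $ k) \<longlongrightarrow> G r $ i $ k) (at_left r)"
      unfolding G_def matrix_matrix_mult_def deformed_laplacian_nth vec_lambda_beta
      by (intro tendsto_intros) (auto intro!: tendsto_intros)
    then show ?thesis by (simp add: G_def N)
  qed
  have "\<forall>\<^sub>F t in at_left r. \<forall>i k. \<bar>G t $ i $ k - mat 1 $ i $ k\<bar> < 1 / (2 * ?n)"
    using G_lim n by (intro eventually_all_finite) (auto simp: tendsto_iff dist_real_def)
  moreover have "\<forall>\<^sub>F t in at_left r. 0 < t \<and> t < r"
    using eventually_at_left_real[OF \<open>0 < r\<close>] by eventually_elim simp
  ultimately have near: "\<forall>\<^sub>F t in at_left r. 0 < t \<and> t < r \<and>
      (\<forall>i k. \<bar>G t $ i $ k - mat 1 $ i $ k\<bar> < 1 / (2 * ?n))"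
    by eventually_elim auto
  \<comment> \<open>Chosen so that the sum \<open>a\<close> of all entries of \<open>F\<close> will
    satisfy \<open>a \<le> B / 2 + a / 2\<close>.\<close>
  define B where "B = 2 * (1 + r\<^sup>2) * (\<Sum>i\<in>UNIV. \<Sum>j\<in>UNIV. \<bar>N $ i $ j\<bar>)"
  have bounded: "(\<Sum>k<K. nb_count E k * t ^ k) \<le> B"
    if t: "0 < t" "t < r" and Gt: "\<forall>i k. \<bar>G t $ i $ k - mat 1 $ i $ k\<bar> < 1 / (2 * ?n)" for t K
  proof -
    have summ: "summable (\<lambda>k. nb_count E k * t ^ k)"
      using t r by (intro summable_in_conv_radius) simp
    define F where "F = nb_gf E t"
    have F0: "0 \<le> F $ i $ j" and Fsumm: "summable (\<lambda>k. p_mat E k $ i $ j * t ^ k)" for i j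
    proof -
      show "summable (\<lambda>k. p_mat E k $ i $ j * t ^ k)"
        using t p_mat_nonneg[of E] p_mat_le_nb_count[of E]
        by (intro summable_comparison_test'[OF summ]) (auto simp: abs_mult intro: mult_right_mono)
      then show "0 \<le> F $ i $ j" unfolding F_def nb_gf_def
        using t by (simp add: suminf_nonneg p_mat_nonneg)
    qed
    define a where "a = (\<Sum>i\<in>UNIV. \<Sum>j\<in>UNIV. F $ i $ j)"
    have "G t ** F = N ** (deformed_laplacian E t ** F)"
      by (simp add: G_def matrix_mul_assoc)
    also have "\<dots> = N ** ((1 - t\<^sup>2) *\<^sub>R mat 1)"
      using nb_gf_equation[OF _ summ] t by (simp add: F_def)
    finally have GF: "(\<Sum>k\<in>UNIV. G t $ i $ k * F $ k $ j) = (1 - t\<^sup>2) * N $ i $ j" for i j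
      by (auto simp: vec_eq_iff matrix_matrix_mult_def mat_def if_distrib if_distribR sum.If_cases
          mult.commute cong: if_cong)
    \<comment> \<open>Entrywise form of \<open>F = (1 - t\<^sup>2) N + (I - G) F\<close>, where the
      entries of \<open>I - G\<close> are below \<open>1 / (2 * ?n)\<close> and those of
      \<open>F\<close> are nonnegative.\<close>
    have F_le: "F $ i $ j \<le> (1 + r\<^sup>2) * \<bar>N $ i $ j\<bar> + (\<Sum>k\<in>UNIV. F $ k $ j) / (2 * ?n)" for i j
    proof -
      have "F $ i $ j = (\<Sum>k\<in>UNIV. mat 1 $ i $ k * F $ k $ j)"
        by (simp add: mat_def if_distrib if_distribR cong: if_cong)
      also have "\<dots> = (1 - t\<^sup>2) * N $ i $ j + (\<Sum>k\<in>UNIV. (mat 1 $ i $ k - G t $ i $ k) * F $ k $ j)"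
        unfolding GF[symmetric] by (simp add: algebra_simps sum_subtractf sum.distrib)
      \<comment> \<open>Here \<open>r\<close> may exceed 1, so the factor can be negative and is
        estimated in absolute value.\<close>
      also have "(1 - t\<^sup>2) * N $ i $ j \<le> (1 + r\<^sup>2) * \<bar>N $ i $ j\<bar>"
      proof -
        have "t\<^sup>2 \<le> r\<^sup>2" using t by (intro power_mono) auto
        then have "\<bar>1 - t\<^sup>2\<bar> \<le> 1 + r\<^sup>2" by (smt (verit) zero_le_power2)
        then have "\<bar>1 - t\<^sup>2\<bar> * \<bar>N $ i $ j\<bar> \<le> (1 + r\<^sup>2) * \<bar>N $ i $ j\<bar>" by (intro mult_right_mono) auto
        then show ?thesis using abs_ge_self order_trans unfolding abs_mult[symmetric] by blast
      qed
      also have "(\<Sum>k\<in>UNIV. (mat 1 $ i $ k - G t $ i $ k) * F $ k $ j) \<le>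
          (\<Sum>k\<in>UNIV. 1 / (2 * ?n) * F $ k $ j)"
        using Gt F0 by (intro sum_mono mult_right_mono) (smt (verit), auto)
      also have "\<dots> = (\<Sum>k\<in>UNIV. F $ k $ j) / (2 * ?n)" by (simp add: sum_divide_distrib)
      finally show ?thesis by simp
    qed
    have "a \<le> (\<Sum>i\<in>UNIV. \<Sum>j\<in>UNIV. (1 + r\<^sup>2) * \<bar>N $ i $ j\<bar> + (\<Sum>k\<in>UNIV. F $ k $ j) / (2 * ?n))"
      unfolding a_def by (intro sum_mono F_le)
    also have "\<dots> = B / 2 + (\<Sum>i\<in>(UNIV :: 'n set). \<Sum>j\<in>UNIV. (\<Sum>k\<in>UNIV. F $ k $ j) / (2 * ?n))"
    proof -
      have "B / 2 = (1 + r\<^sup>2) * (\<Sum>i\<in>UNIV. \<Sum>j\<in>UNIV. \<bar>N $ i $ j\<bar>)" by (simp add: B_def)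
      then show ?thesis by (simp only: sum.distrib sum_distrib_left)
    qed
    \<comment> \<open>The sum over \<open>i\<close> repeats the column sums \<open>?n\<close> times,
      which leaves half of the total.\<close>
    also have "(\<Sum>i\<in>(UNIV :: 'n set). \<Sum>j\<in>UNIV. (\<Sum>k\<in>UNIV. F $ k $ j) / (2 * ?n)) =
        (\<Sum>j\<in>UNIV. \<Sum>k\<in>UNIV. F $ k $ j) / 2"
      by (simp flip: sum_divide_distrib)
    also have "(\<Sum>j\<in>UNIV. \<Sum>k\<in>UNIV. F $ k $ j) = a" unfolding a_def by (rule sum.swap)
    finally have "a \<le> B" by simp
    have "(\<Sum>k<K. nb_count E k * t ^ k) = (\<Sum>i\<in>UNIV. \<Sum>j\<in>UNIV. \<Sum>k<K. p_mat E k $ i $ j * t ^ k)"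
      by (simp add: nb_count_eq_sum sum_distrib_right sum.swap[of _ "{..<K}"])
    also have "\<dots> \<le> a"
      unfolding a_def F_def nb_gf_def vec_lambda_beta
      using t by (intro sum_mono sum_le_suminf Fsumm) (auto simp: p_mat_nonneg)
    finally show ?thesis using \<open>a \<le> B\<close> by simp
  qed
  \<comment> \<open>Partial sums are continuous in \<open>t\<close>, so the bound passes to
    \<open>r\<close> itself.\<close>
  have "(\<Sum>k<K. nb_count E k * r ^ k) \<le> B" for K
  proof (rule tendsto_upperbound)
    show "((\<lambda>t. \<Sum>k<K. nb_count E k * t ^ k) \<longlongrightarrow> (\<Sum>k<K. nb_count E k * r ^ k)) (at_left r)"
      by (intro tendsto_intros)
    show "\<forall>\<^sub>F t in at_left r. (\<Sum>k<K. nb_count E k * t ^ k) \<le> B"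
      using near by eventually_elim (use bounded in blast)
  qed simp
  then have "summable (\<lambda>k. nb_count E k * r ^ k)"
    using \<open>0 < r\<close> by (intro summableI_nonneg_bounded) (auto simp: nb_count_nonneg)
  then show False using not_summable_at_conv_radius[OF r] by simp
qed

section \<open>From the radius of convergence to the smallest eigenvalue\<close>

lemma conv_radius_antimono:
  fixes f g :: "nat \<Rightarrow> real"
  assumes "\<And>k. \<bar>f k\<bar> \<le> c * g k" "\<And>k. 0 \<le> g k"
  shows "conv_radius g \<le> conv_radius f"
proof (rule conv_radius_geI_ex')
  fix r :: real assume r: "0 < r" "ereal r < conv_radius g"
  have "summable (\<lambda>n. c * (g n * r ^ n))"
    using r by (intro summable_mult summable_in_conv_radius) simp
  then show "summable (\<lambda>n. f n * of_real r ^ n)"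
  proof (rule summable_comparison_test')
    fix n
    show "norm (f n * of_real r ^ n) \<le> c * (g n * r ^ n)"
      using r mult_right_mono[OF assms(1), of "r ^ n" n] by (simp add: abs_mult mult.assoc)
  qed
qed

text \<open>The norm of a matrix and the sum of its nonnegative entries bound each other up to a
  constant.\<close>

lemma conv_radius_p_mat: "conv_radius (p_mat E) = conv_radius (nb_count E)"
proof -
  have "norm (p_mat E k) \<le> nb_count E k" for k
  proof -
    have "norm (p_mat E k) \<le> (\<Sum>i\<in>UNIV. norm (p_mat E k $ i))"
      unfolding norm_vec_def by (rule L2_set_le_sum) simp
    also have "\<dots> \<le> (\<Sum>i\<in>UNIV. \<Sum>j\<in>UNIV. \<bar>p_mat E k $ i $ j\<bar>)"
      by (intro sum_mono norm_le_l1_cart)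
    finally show ?thesis by (simp add: nb_count_eq_sum p_mat_nonneg)
  qed
  then have "conv_radius (nb_count E) \<le> conv_radius (\<lambda>k. norm (p_mat E k))"
    by (intro conv_radius_antimono[of _ 1]) (auto simp: nb_count_nonneg)
  moreover have "nb_count E k \<le> real CARD('a) * real CARD('a) * norm (p_mat E k)" for k
  proof -
    have "p_mat E k $ i $ j \<le> norm (p_mat E k)" for i j
      using Finite_Cartesian_Product.norm_nth_le[of "p_mat E k $ i" j]
        Finite_Cartesian_Product.norm_nth_le[of "p_mat E k" i] by simp
    then have "nb_count E k \<le> (\<Sum>i\<in>(UNIV :: 'a set). \<Sum>j\<in>(UNIV :: 'a set). norm (p_mat E k))"
      unfolding nb_count_eq_sum by (intro sum_mono)
    then show ?thesis by simp
  qed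
  then have "conv_radius (\<lambda>k. norm (p_mat E k)) \<le> conv_radius (nb_count E)"
    by (intro conv_radius_antimono[of _ "real CARD('a) * real CARD('a)"]) (auto simp: nb_count_nonneg)
  ultimately show ?thesis by (simp only: conv_radius_norm)
qed

text \<open>On the reals \<open>LEAST\<close> is meaningful only where a minimum exists, so one is
  exhibited.\<close>

lemma mu_eig_eqI:
  assumes "0 < m" "det (deformed_laplacian E m) = 0"
    and "\<And>t. 0 < t \<Longrightarrow> t < m \<Longrightarrow> det (deformed_laplacian E t) \<noteq> 0"
  shows "mu_eig E = m"
  unfolding mu_eig_def using assms by (intro Least_equality) (auto simp: not_less[symmetric])

text \<open>The determinant has no positive zero below both 1 and the radius, while 1 and a finite
  radius are zeros.\<close>

theorem mu_eig_eq:
  fixes E :: "'n::finite \<Rightarrow> 'n \<Rightarrow> bool"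
  shows "ereal (mu_eig E) = min 1 (conv_radius (nb_count E))"
proof (cases "conv_radius (nb_count E) < 1")
  case True
  then obtain r where r: "conv_radius (nb_count E) = ereal r" "r < 1"
    using conv_radius_nonneg[of "nb_count E"] by (cases "conv_radius (nb_count E)") auto
  have "mu_eig E = r"
  proof (rule mu_eig_eqI)
    show "0 < r" using conv_radius_nb_count_pos[of E] r by simp
    show "det (deformed_laplacian E t) \<noteq> 0" if "0 < t" "t < r" for t
      using that r by (intro det_deformed_laplacian_nonzero) auto
  qed (rule det_deformed_laplacian_conv_radius[OF r(1)])
  then show ?thesis using r by simp
next
  case False
  then have ge: "1 \<le> conv_radius (nb_count E)" by simp
  have "mu_eig E = 1"
  proof (rule mu_eig_eqI)
    show "det (deformed_laplacian E t) \<noteq> 0" if "0 < t" "t < 1" for t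
    proof (rule det_deformed_laplacian_nonzero[OF that])
      have "ereal t < 1" using that by simp
      then show "ereal t < conv_radius (nb_count E)" using ge by (rule less_le_trans)
    qed
  qed (simp_all add: det_deformed_laplacian_1)
  then show ?thesis using False by (simp add: one_ereal_def)
qed

theorem theorem3p13:
  fixes E :: "'n::finite \<Rightarrow> 'n \<Rightarrow> bool"
  assumes noloops: "\<forall>i. \<not> E i i"
  shows
    "((\<forall>C\<in>scc_classes E. is_tree C (undir_adj E C) \<or> is_isolated_node C (undir_adj E C))
        \<longrightarrow> mu_eig E = 1 \<and> ereal (mu_eig E) < conv_radius (p_mat E) \<and> conv_radius (p_mat E) = \<infinity>)
     \<and> ((\<forall>C\<in>scc_classes E. card (cycles C (undir_adj E C)) \<le> 1)
          \<and> (\<exists>C\<in>scc_classes E. card (cycles C (undir_adj E C)) = 1)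
        \<longrightarrow> mu_eig E = 1 \<and> conv_radius (p_mat E) = ereal (mu_eig E))
     \<and> ((\<exists>C\<in>scc_classes E. card (cycles C (undir_adj E C)) > 1)
        \<longrightarrow> mu_eig E < 1 \<and> conv_radius (p_mat E) = ereal (mu_eig E))"
proof (rule conjI[OF _ conjI]; rule impI)
  assume trees: "\<forall>C\<in>scc_classes E. is_tree C (undir_adj E C) \<or> is_isolated_node C (undir_adj E C)"
  have "cycles C (undir_adj E C) = {}" if C: "C \<in> scc_classes E" for C
  proof (cases "is_tree C (undir_adj E C)")
    case True
    then show ?thesis by (simp add: is_tree_def)
  next
    case False
    then have "card C = 1" using trees C by (auto simp: is_isolated_node_def)
    \<comment> \<open>A cycle has at least three vertices, too many for a single node.\<close>
    moreover have "card (set vs) \<le> card C" if "set vs \<subseteq> C" for vs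
      using that by (intro card_mono) auto
    ultimately have "\<not> is_cycle_list C (undir_adj E C) vs" for vs
      by (metis distinct_card is_cycle_list_def le_trans not_one_le_zero numeral_le_one_iff semiring_norm(70))
    then show ?thesis by (simp add: cycles_def)
  qed
  then have "nb_count E k = 0" if "k \<ge> CARD('n)" for k
    using scc_acyclic_nb_count noloops that by blast
  \<comment> \<open>Only finitely many terms are nonzero.\<close>
  then have "conv_radius (nb_count E) = conv_radius (\<lambda>_. 0 :: real)"
    by (intro conv_radius_cong' eventually_sequentiallyI)
  then have "conv_radius (nb_count E) = \<infinity>" by simp
  moreover from this have "ereal (mu_eig E) = 1" using mu_eig_eq[of E] by simp
  ultimately show "mu_eig E = 1 \<and> ereal (mu_eig E) < conv_radius (p_mat E) \<and> conv_radius (p_mat E) = \<infinity>"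
    by (simp add: conv_radius_p_mat one_ereal_def)
next
  assume one: "(\<forall>C\<in>scc_classes E. card (cycles C (undir_adj E C)) \<le> 1)
      \<and> (\<exists>C\<in>scc_classes E. card (cycles C (undir_adj E C)) = 1)"
  then obtain C where "C \<in> scc_classes E" "card (cycles C (undir_adj E C)) = 1" by blast
  \<comment> \<open>Cardinality 1 excludes the empty set of cycles.\<close>
  then have "conv_radius (nb_count E) \<le> 1"
    by (intro scc_cycle_conv_radius) auto
  moreover have "1 \<le> conv_radius (nb_count E)"
    using sccs_le_one_cycle_conv_radius noloops one by blast
  ultimately have "conv_radius (nb_count E) = 1" by simp
  moreover from this have "ereal (mu_eig E) = 1" using mu_eig_eq[of E] by simp
  ultimately show "mu_eig E = 1 \<and> conv_radius (p_mat E) = ereal (mu_eig E)"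
    by (simp add: conv_radius_p_mat one_ereal_def)
next
  assume "\<exists>C\<in>scc_classes E. card (cycles C (undir_adj E C)) > 1"
  then have lt: "conv_radius (nb_count E) < 1" using scc_two_cycles_conv_radius by blast
  then have "ereal (mu_eig E) = conv_radius (nb_count E)" using mu_eig_eq[of E] by (simp add: min.absorb2 less_imp_le)
  then show "mu_eig E < 1 \<and> conv_radius (p_mat E) = ereal (mu_eig E)"
    using lt by (simp add: conv_radius_p_mat flip: \<open>ereal (mu_eig E) = _\<close>)
qed

end
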